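(* Let $\Delta$ be a simple hypergraph on the vertex set $V=\{1,\dots,n\}$, let $R=K[x_1,\dots,x_n]$ be a polynomial ring over a field $K$, and let $I = I(\Delta)\subseteq R$ be the edge ideal of $\Delta$. Then $\overline{I^k} = I^{(k)}$ for all $k \ge 1$ if and only if $\Delta$ is a Fulkersonian hypergraph.
   Context: A hypergraph $\Delta$ on the finite set $V=\{1,\dots,n\}$ is a family (set) of subsets of $V$; the elements of $V$ are its vertices and the members of $\Delta$ are its edges. $\Delta$ is simple if there are no inclusions between distinct edges of $\Delta$. Edge ideal: $I(\Delta)$ is the ideal of $R=K[x_1,\dots,x_n]$ generated by all monomials $\prod_{i\in F}x_i$ with $F\in\Delta$. Symbolic powers: a vertex cover of $\Delta$ is a subset $C\subseteq V$ meeting every edge of $\Delta$; let $\Delta^*$ be the hypergraph on $V$ whose edges are the inclusion-minimal vertex covers of $\Delta$. For $C\subseteq V$ put $P_C=(x_i \mid i\in C)\subseteq R$. Then $I(\Delta)=\bigcap_{C\in\Delta^*}P_C$, and for $k\ge 1$ the $k$-th symbolic power of $I=I(\Delta)$ is $I^{(k)}=\bigcap_{C\in\Delta^*}P_C^k$ (an empty intersection being $R$). Integral closure: $\overline{J}$ denotes the integral closure of an ideal $J$ in $R$, i.e. the set of $f\in R$ satisfying an equation $f^s+a_1f^{s-1}+\cdots+a_s=0$ for some $s\geq 1$ with $a_j\in J^j$ for all $j$. Fulkersonian hypergraph: let $F_1,\dots,F_m$ be the edges of $\Delta$ and let $M=(e_{ij})$ be the $n\times m$ incidence matrix of $\Delta$,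 with $e_{ij}=1$ if $i\in F_j$ and $e_{ij}=0$ otherwise. Let $\mathbb{R}_+$ be the set of non-negative real numbers, let $\mathbf{1}$ be the all-ones vector of length $m$, and put $Q(\Delta)=\{\mathbf{a}\in\mathbb{R}_+^n \mid M^T\cdot\mathbf{a}\ge \mathbf{1}\}$ (componentwise inequality), i.e. the set of $\mathbf{a}\in\mathbb{R}_+^n$ with $\sum_{i\in F}a_i\ge 1$ for all $F\in\Delta$. $\Delta$ is called Fulkersonian if $Q(\Delta)$ only has integral extremal points, i.e. every extreme point of $Q(\Delta)$ has integer coordinates. *)

theory Defs
  imports "HOL-Analysis.Analysis" "HOL-Library.Poly_Mapping"
begin

text \<open>
  The vertex set is the carrier of a finite type \<open>'n\<close>, so that \<open>n = CARD('n)\<close>.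
  The polynomial ring \<open>K[x\<^sub>i | i \<in> V]\<close> is the monoid ring of the exponent
  vectors \<open>'n \<Rightarrow>\<^sub>0 nat\<close> over the field \<open>'k\<close>.
\<close>

type_synonym ('n, 'k) mpoly = "('n \<Rightarrow>\<^sub>0 nat) \<Rightarrow>\<^sub>0 'k"

definition Var :: "'n \<Rightarrow> ('n, 'k::field) mpoly" where
  "Var i = Poly_Mapping.single (Poly_Mapping.single i 1) 1"

text \<open>Ideals of a commutative ring are the submodules of the ring over itself.\<close>

global_interpretation ideal: module "(*) :: 'a::comm_ring_1 \<Rightarrow> 'a \<Rightarrow> 'a"
  defines ideal_generated = ideal.span
  by unfold_locales (simp_all add: algebra_simps)

fun ideal_power :: "'a::comm_ring_1 set \<Rightarrow> nat \<Rightarrow> 'a set" where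
  "ideal_power J 0 = UNIV"
| "ideal_power J (Suc k) = ideal_generated {a * b | a b. a \<in> J \<and> b \<in> ideal_power J k}"

definition integral_closure :: "'a::comm_ring_1 set \<Rightarrow> 'a set" where
  "integral_closure J =
    {f. \<exists>s\<ge>1. \<exists>a. (\<forall>j\<in>{1..s}. a j \<in> ideal_power J j) \<and>
        f ^ s + (\<Sum>j=1..s. a j * f ^ (s - j)) = 0}"

definition simple_hypergraph :: "'n set set \<Rightarrow> bool" where
  "simple_hypergraph \<Delta> \<longleftrightarrow> (\<forall>F\<in>\<Delta>. \<forall>G\<in>\<Delta>. F \<subseteq> G \<longrightarrow> F = G)"

definition vertex_cover :: "'n set set \<Rightarrow> 'n set \<Rightarrow> bool" where
  "vertex_cover \<Delta> C \<longleftrightarrow> (\<forall>F\<in>\<Delta>. C \<inter> F \<noteq> {})"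

definition minimal_vertex_covers :: "'n set set \<Rightarrow> 'n set set" where
  "minimal_vertex_covers \<Delta> =
    {C. vertex_cover \<Delta> C \<and> (\<forall>D. vertex_cover \<Delta> D \<and> D \<subseteq> C \<longrightarrow> D = C)}"

definition edge_ideal :: "'n set set \<Rightarrow> ('n, 'k::field) mpoly set" where
  "edge_ideal \<Delta> = ideal_generated ((\<lambda>F. \<Prod>i\<in>F. Var i) ` \<Delta>)"

definition cover_prime :: "'n set \<Rightarrow> ('n, 'k::field) mpoly set" where
  "cover_prime C = ideal_generated (Var ` C)"

text \<open>
  The symbolic powers of the edge ideal of \<open>\<Delta>\<close>, given by the prime
  decomposition of the edge ideal. An empty intersection is the whole ring.
\<close>

definition symbolic_power :: "'n set set \<Rightarrow> nat \<Rightarrow> ('n, 'k::field) mpoly set" where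
  "symbolic_power \<Delta> k = (\<Inter>C\<in>minimal_vertex_covers \<Delta>. ideal_power (cover_prime C) k)"

text \<open>
  The system \<open>M\<^sup>T a \<ge> 1\<close> for the incidence matrix \<open>M\<close> is written out edge by edge.
\<close>

definition cover_polyhedron :: "'n::finite set set \<Rightarrow> (real ^ 'n) set" where
  "cover_polyhedron \<Delta> = {a. (\<forall>i. 0 \<le> a $ i) \<and> (\<forall>F\<in>\<Delta>. 1 \<le> (\<Sum>i\<in>F. a $ i))}"

definition fulkersonian :: "'n::finite set set \<Rightarrow> bool" where
  "fulkersonian \<Delta> \<longleftrightarrow>
    (\<forall>a. a extreme_point_of cover_polyhedron \<Delta> \<longrightarrow> (\<forall>i. a $ i \<in> \<int>))"

end

theory Submission
  imports Defs "Jordan_Normal_Form.Determinant" "HOL-Analysis.Kronecker_Approximation_Theorem"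
begin

text \<open>
  Both sides of the equation \<open>integral closure of I\<^sup>k = k-th symbolic power\<close> are monomial, so membership
  can be read off from the exponent vectors \<open>a\<close> of the terms of a polynomial. Let \<open>Q\<close> be the cover
  polyhedron of \<open>\<Delta>\<close>. A polynomial lies in the symbolic power iff \<open>a \<bullet> 1\<^sub>C \<ge> k\<close> for each of its
  exponents \<open>a\<close> and each minimal vertex cover \<open>C\<close>. It is integral over \<open>I\<^sup>k\<close> iff \<open>a \<bullet> w \<ge> k\<close> for
  each of its exponents \<open>a\<close> and \<^emph>\<open>all\<close> \<open>w \<in> Q\<close>
  (\<open>integral_closure_edge_ideal_power_iff\<close>).

  The points \<open>1\<^sub>C\<close> lie in \<open>Q\<close>, so what is left is to compare the minimum of linear forms \<open>a\<close> over
  \<open>Q\<close> with their minimum over the points \<open>1\<^sub>C\<close>. A linear form with nonnegative coefficients takes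
  its infimum over \<open>Q\<close> at an extreme point; an integral point of \<open>Q\<close> dominates \<open>1\<^sub>C\<close> for a minimal
  cover \<open>C\<close>, namely one inside its support. Hence the two minima agree if \<open>\<Delta>\<close> is Fulkersonian
  (\<open>fulkersonian_cover_bound\<close>). Conversely, if they agree for all \<open>a\<close>, then a separation argument
  shows that every point of \<open>Q\<close> dominates a convex combination of the \<open>1\<^sub>C\<close>; an extreme point must
  then be one of the \<open>1\<^sub>C\<close> itself (\<open>cover_bound_fulkersonian\<close>).

  The description of the integral closure has two halves. If \<open>f\<close> is integral over \<open>I\<^sup>k\<close>, then a
  suitable exponent \<open>a\<close> of \<open>f\<close> of least \<open>w\<close>-weight survives without cancellation in \<open>f\<^sup>s\<close>, and
  comparing weights in an equation of integral dependence gives \<open>a \<bullet> w \<ge> k\<close>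
  (\<open>weight_ge_of_integral\<close>). For the other half, convex separation writes \<open>a\<close>, up to a nonnegative
  vector, as a nonnegative real combination of edge vectors with coefficients of sum \<open>k\<close>;
  simultaneous Diophantine approximation turns it into an integral one, so some \<open>q\<close>-th power of the
  monomial \<open>x\<^sup>a\<close> lies in \<open>I\<^sup>k\<^sup>q\<close> (\<open>multiple_in_power\<close>). That polynomials with such
  exponents only are integral over \<open>I\<^sup>k\<close> is a determinant trick on the module spanned by the
  monomials of one fixed large degree in the generators of \<open>I\<^sup>k\<close> and the terms of \<open>f\<close>
  (\<open>integral_of_monomial_powers\<close>).
\<close>

(* Throughout, the symbols for component access and inner product belong to real ^ 'n. *)
no_notation Matrix.vec_index (infixl "$" 100)
no_notation Matrix.scalar_prod (infix "\<bullet>" 70)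

section \<open>The determinant trick\<close>

(* For a ring as a module over itself, scale_scale is the reverse of mult.assoc and loops with it. *)
declare ideal_power.simps(2) [simp del] ideal.scale_scale [simp del]

lemma ideal_power_zero: "0 \<in> ideal_power J j"
  by (cases j) (simp_all only: ideal_power.simps ideal.span_zero UNIV_I)

lemma ideal_power_add:
  "\<lbrakk>x \<in> ideal_power J j; y \<in> ideal_power J j\<rbrakk> \<Longrightarrow> x + y \<in> ideal_power J j"
  by (cases j) (simp_all only: ideal_power.simps ideal.span_add UNIV_I)

lemma ideal_power_scale: "x \<in> ideal_power J j \<Longrightarrow> c * x \<in> ideal_power J j"
  by (cases j) (simp_all only: ideal_power.simps ideal.span_scale UNIV_I)

lemma ideal_power_Suc_mult:
  "\<lbrakk>b \<in> J; x \<in> ideal_power J j\<rbrakk> \<Longrightarrow> b * x \<in> ideal_power J (Suc j)"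
  unfolding ideal_power.simps by (rule ideal.span_base) blast

text \<open>
  In these terms, \<open>f\<close> is integral over \<open>J\<close> iff \<open>f\<^sup>q + t = 0\<close> for some \<open>q \<ge> 1\<close> and some
  \<open>t\<close> in this set.
\<close>

definition lower_order_terms :: "'a::comm_ring_1 set \<Rightarrow> 'a \<Rightarrow> nat \<Rightarrow> 'a set" where
  "lower_order_terms J f q =
    {\<Sum>j=1..q. a j * f ^ (q - j) | a. \<forall>j\<in>{1..q}. a j \<in> ideal_power J j}"

lemma lower_order_termsI:
  "\<lbrakk>\<And>j. j \<in> {1..q} \<Longrightarrow> a j \<in> ideal_power J j; x = (\<Sum>j=1..q. a j * f ^ (q - j))\<rbrakk>
    \<Longrightarrow> x \<in> lower_order_terms J f q"
  unfolding lower_order_terms_def by blast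

lemma lower_order_termsE:
  assumes "x \<in> lower_order_terms J f q"
  obtains a where "\<forall>j\<in>{1..q}. a j \<in> ideal_power J j" "x = (\<Sum>j=1..q. a j * f ^ (q - j))"
  using assms unfolding lower_order_terms_def by blast

lemma subspace_lower_order_terms: "ideal.subspace (lower_order_terms J f q)"
proof (rule ideal.subspaceI)
  show "0 \<in> lower_order_terms J f q"
    by (rule lower_order_termsI[of _ "\<lambda>_. 0"]) (simp_all add: ideal_power_zero)
next
  fix x y assume "x \<in> lower_order_terms J f q" "y \<in> lower_order_terms J f q"
  then obtain a b
    where a: "\<forall>j\<in>{1..q}. a j \<in> ideal_power J j" "x = (\<Sum>j=1..q. a j * f ^ (q - j))"
      and b: "\<forall>j\<in>{1..q}. b j \<in> ideal_power J j" "y = (\<Sum>j=1..q. b j * f ^ (q - j))"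
    by (elim lower_order_termsE) rule
  show "x + y \<in> lower_order_terms J f q"
  proof (rule lower_order_termsI)
    show "a j + b j \<in> ideal_power J j" if "j \<in> {1..q}" for j
      using a(1) b(1) that by (simp add: ideal_power_add)
    show "x + y = (\<Sum>j=1..q. (a j + b j) * f ^ (q - j))"
      by (simp add: a(2) b(2) sum.distrib distrib_right)
  qed
next
  fix c x assume "x \<in> lower_order_terms J f q"
  then obtain a
    where a: "\<forall>j\<in>{1..q}. a j \<in> ideal_power J j" "x = (\<Sum>j=1..q. a j * f ^ (q - j))"
    by (rule lower_order_termsE)
  show "c * x \<in> lower_order_terms J f q"
  proof (rule lower_order_termsI)
    show "c * a j \<in> ideal_power J j" if "j \<in> {1..q}" for j
      using a(1) that by (simp add: ideal_power_scale)
    show "c * x = (\<Sum>j=1..q. (c * a j) * f ^ (q - j))"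
      by (simp add: a(2) sum_distrib_left mult.assoc)
  qed
qed

lemma lower_order_terms_single:
  assumes "1 \<le> j" "j \<le> q" "x \<in> ideal_power J j"
  shows "x * f ^ (q - j) \<in> lower_order_terms J f q"
proof -
  have "(\<Sum>i=1..q. (if i = j then x else 0) * f ^ (q - i)) = (\<Sum>i=1..q. if i = j then x * f ^ (q - j) else 0)"
    by (intro sum.cong) auto
  also have "\<dots> = x * f ^ (q - j)"
    using assms by simp
  finally have "x * f ^ (q - j) = (\<Sum>i=1..q. (if i = j then x else 0) * f ^ (q - i))" ..
  then show ?thesis
    by (rule lower_order_termsI[rotated]) (use assms in \<open>auto simp: ideal_power_zero\<close>)
qed

text \<open>
  Expanding the product, each factor contributes either \<open>d i * f\<close> or an element of \<open>J\<close>. In the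
  application to a determinant, \<open>d\<close> runs along a permutation in the identity matrix.
\<close>

lemma prod_diff_lower_order_terms:
  fixes f :: "'a::comm_ring_1"
  assumes "finite I" "\<And>i. i \<in> I \<Longrightarrow> b i \<in> J"
  shows "(\<Prod>i\<in>I. d i * f - b i) - (\<Prod>i\<in>I. d i) * f ^ card I \<in> lower_order_terms J f (card I)"
  using assms
proof (induction I rule: finite_induct)
  case empty
  then show ?case by (simp add: ideal.subspace_0[OF subspace_lower_order_terms])
next
  case (insert i I)
  let ?q = "card I" and ?D = "\<Prod>i\<in>I. d i"
  have b: "b i \<in> J" using insert by simp
  have "(\<Prod>i\<in>I. d i * f - b i) - ?D * f ^ ?q \<in> lower_order_terms J f ?q"
    using insert.IH insert.prems by simp
  then obtain a where aJ: "\<forall>j\<in>{1..?q}. a j \<in> ideal_power J j"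
    and a: "(\<Prod>i\<in>I. d i * f - b i) - ?D * f ^ ?q = (\<Sum>j=1..?q. a j * f ^ (?q - j))"
    by (rule lower_order_termsE)
  let ?T = "lower_order_terms J f (Suc ?q)"
  have eq: "(\<Prod>i\<in>insert i I. d i * f - b i) - (\<Prod>i\<in>insert i I. d i) * f ^ card (insert i I)
     = d i * (\<Sum>j=1..?q. a j * f ^ (Suc ?q - j)) - (\<Sum>j=1..?q. (b i * a j) * f ^ (Suc ?q - Suc j))
       - ?D * (b i * f ^ (Suc ?q - 1))"
  proof -
    have 1: "(\<Sum>j=1..?q. a j * f ^ (Suc ?q - j)) = f * (\<Sum>j=1..?q. a j * f ^ (?q - j))"
      unfolding sum_distrib_left by (intro sum.cong) (auto simp: Suc_diff_le)
    have 2: "(\<Sum>j=1..?q. (b i * a j) * f ^ (Suc ?q - Suc j)) = b i * (\<Sum>j=1..?q. a j * f ^ (?q - j))"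
      unfolding sum_distrib_left by (simp add: mult.assoc)
    show ?thesis
      unfolding 1 2 a[symmetric] prod.insert[OF insert.hyps] card_insert_disjoint[OF insert.hyps]
      by (simp add: algebra_simps)
  qed
  have "a j * f ^ (Suc ?q - j) \<in> ?T" if "j \<in> {1..?q}" for j
    using aJ that by (intro lower_order_terms_single) simp_all
  then have 1: "(\<Sum>j=1..?q. a j * f ^ (Suc ?q - j)) \<in> ?T"
    by (rule ideal.subspace_sum[OF subspace_lower_order_terms])
  have "(b i * a j) * f ^ (Suc ?q - Suc j) \<in> ?T" if "j \<in> {1..?q}" for j
    using aJ that b by (intro lower_order_terms_single ideal_power_Suc_mult) simp_all
  then have 2: "(\<Sum>j=1..?q. (b i * a j) * f ^ (Suc ?q - Suc j)) \<in> ?T"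
    by (rule ideal.subspace_sum[OF subspace_lower_order_terms])
  have 3: "b i * f ^ (Suc ?q - 1) \<in> ?T"
    using ideal_power_Suc_mult[OF b, of 1 0] by (intro lower_order_terms_single) simp_all
  have "d i * (\<Sum>j=1..?q. a j * f ^ (Suc ?q - j)) - (\<Sum>j=1..?q. (b i * a j) * f ^ (Suc ?q - Suc j))
       - ?D * (b i * f ^ (Suc ?q - 1)) \<in> ?T"
    by (intro ideal.subspace_diff ideal.subspace_scale[OF _ 1] ideal.subspace_scale[OF _ 3] 2
        subspace_lower_order_terms)
  then show ?case
    unfolding eq unfolding card_insert_disjoint[OF insert.hyps] .
qed

text \<open>
  If multiplication by \<open>f\<close> maps a finitely generated module \<open>M\<close> into \<open>J M\<close>, say by a matrix \<open>B\<close>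
  on generators \<open>v\<close>, then \<open>det (f - B)\<close> kills \<open>M\<close>. If one of the generators is not a zero divisor,
  the determinant vanishes, and its Leibniz expansion is an equation of integral dependence, since
  the only term without a factor from \<open>J\<close> is \<open>f\<^sup>p\<close>.
\<close>

theorem determinant_trick:
  fixes f :: "'a::comm_ring_1" and v :: "'i \<Rightarrow> 'a"
  assumes "finite G" "g \<in> G" and nzd: "\<And>x. x * v g = 0 \<Longrightarrow> x = 0"
    and BJ: "\<And>i j. i \<in> G \<Longrightarrow> j \<in> G \<Longrightarrow> B i j \<in> J"
    and fv: "\<And>i. i \<in> G \<Longrightarrow> f * v i = (\<Sum>j\<in>G. B i j * v j)"
  shows "f \<in> integral_closure J"
proof -
  define p where "p = card G"
  obtain h where h: "bij_betw h {0..<p} G"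
    using ex_bij_betw_nat_finite[OF \<open>finite G\<close>] p_def by blast
  have hG: "h i \<in> G" if "i < p" for i using h that by (auto simp: bij_betw_def)
  define \<delta> :: "nat \<Rightarrow> nat \<Rightarrow> 'a" where "\<delta> i j = (if i = j then 1 else 0)" for i j
  define A where "A = mat p p (\<lambda>(i, j). \<delta> i j * f - B (h i) (h j))"
  have A: "A \<in> carrier_mat p p" by (simp add: A_def)
  have row: "(\<Sum>j=0..<p. A $$ (i, j) * v (h j)) = 0" if "i < p" for i
  proof -
    have "(\<Sum>j=0..<p. A $$ (i, j) * v (h j))
       = (\<Sum>j=0..<p. (if j = i then f * v (h i) else 0)) - (\<Sum>j=0..<p. B (h i) (h j) * v (h j))"
      unfolding sum_subtractf[symmetric]
      using that by (intro sum.cong) (auto simp: A_def \<delta>_def algebra_simps)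
    also have "(\<Sum>j=0..<p. B (h i) (h j) * v (h j)) = (\<Sum>j\<in>G. B (h i) j * v j)"
      by (rule sum.reindex_bij_betw[OF h])
    finally show ?thesis using that fv[OF hG[OF that]] by simp
  qed
  define D where "D = Determinant.det A"
  \<comment> \<open>Cramer's rule, in the form \<open>adj A * A = det A\<close>.\<close>
  have Dv: "D * v (h k) = 0" if "k < p" for k
  proof -
    have "D * v (h k) = (\<Sum>j=0..<p. (D \<cdot>\<^sub>m 1\<^sub>m p) $$ (k, j) * v (h j))"
    proof -
      have "(\<Sum>j=0..<p. (D \<cdot>\<^sub>m 1\<^sub>m p) $$ (k, j) * v (h j)) = (\<Sum>j=0..<p. if j = k then D * v (h k) else 0)"
        using that by (intro sum.cong) auto
      then show ?thesis using that by simp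
    qed
    also have "D \<cdot>\<^sub>m 1\<^sub>m p = adj_mat A * A" using adj_mat[OF A] D_def by simp
    also have "(\<Sum>j=0..<p. (adj_mat A * A) $$ (k, j) * v (h j))
       = (\<Sum>j=0..<p. \<Sum>i=0..<p. adj_mat A $$ (k, i) * (A $$ (i, j) * v (h j)))"
      using A adj_mat(1)[OF A] that
      by (intro sum.cong) (auto simp: scalar_prod_def sum_distrib_right mult.assoc)
    also have "\<dots> = (\<Sum>i=0..<p. adj_mat A $$ (k, i) * (\<Sum>j=0..<p. A $$ (i, j) * v (h j)))"
      by (subst sum.swap) (simp add: sum_distrib_left)
    finally show ?thesis using row by simp
  qed
  obtain k where "k < p" "h k = g" using h \<open>g \<in> G\<close> by (auto simp: bij_betw_def)
  then have "D = 0" using Dv nzd by blast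
  have det_delta: "(\<Sum>\<sigma> | \<sigma> permutes {0..<p}. signof \<sigma> * (\<Prod>i=0..<p. \<delta> i (\<sigma> i))) = 1"
  proof -
    have "Determinant.det (1\<^sub>m p :: 'a mat) = (\<Sum>\<sigma> | \<sigma> permutes {0..<p}. signof \<sigma> * (\<Prod>i=0..<p. \<delta> i (\<sigma> i)))"
      unfolding det_def'[OF one_carrier_mat]
      by (intro sum.cong refl arg_cong2[where f="(*)"] prod.cong) (auto simp: \<delta>_def)
    then show ?thesis by simp
  qed
  have "D - f ^ p = (\<Sum>\<sigma> | \<sigma> permutes {0..<p}. signof \<sigma> *
      ((\<Prod>i\<in>{0..<p}. \<delta> i (\<sigma> i) * f - B (h i) (h (\<sigma> i))) - (\<Prod>i\<in>{0..<p}. \<delta> i (\<sigma> i)) * f ^ card {0..<p}))"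
  proof -
    have "D = (\<Sum>\<sigma> | \<sigma> permutes {0..<p}. signof \<sigma> * (\<Prod>i\<in>{0..<p}. \<delta> i (\<sigma> i) * f - B (h i) (h (\<sigma> i))))"
      unfolding D_def det_def'[OF A]
      by (intro sum.cong refl arg_cong2[where f="(*)"] prod.cong) (auto simp: A_def)
    moreover have "f ^ p = (\<Sum>\<sigma> | \<sigma> permutes {0..<p}. signof \<sigma> * ((\<Prod>i=0..<p. \<delta> i (\<sigma> i)) * f ^ p))"
      using det_delta by (simp add: sum_distrib_right[symmetric] mult.assoc[symmetric])
    ultimately show ?thesis by (simp add: sum_subtractf right_diff_distrib)
  qed
  also have "\<dots> \<in> lower_order_terms J f (card {0..<p})"
  proof (intro ideal.subspace_sum ideal.subspace_scale subspace_lower_order_terms prod_diff_lower_order_terms)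
    fix \<sigma> i assume "\<sigma> \<in> {\<sigma>. \<sigma> permutes {0..<p}}" "i \<in> {0..<p}"
    then have "\<sigma> i < p" "i < p" using permutes_in_image[of \<sigma> "{0..<p}" i] by auto
    then show "B (h i) (h (\<sigma> i)) \<in> J" using BJ hG by blast
  qed simp
  finally obtain a where a: "\<forall>j\<in>{1..p}. a j \<in> ideal_power J j"
     and D: "D - f ^ p = (\<Sum>j=1..p. a j * f ^ (p - j))"
    unfolding lower_order_terms_def by auto
  have "f ^ p + (\<Sum>j=1..p. a j * f ^ (p - j)) = 0"
    unfolding D[symmetric] \<open>D = 0\<close> by simp
  then show ?thesis
    unfolding integral_closure_def using a \<open>k < p\<close> by (auto intro!: exI[of _ p] exI[of _ a])
qed



section \<open>Monomial ideals and their powers\<close>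

text \<open>
  The sums of \<open>k\<close> elements of \<open>U\<close>, repetitions allowed: the exponents of the standard generators
  of the \<open>k\<close>-th power of the monomial ideal with generating exponents \<open>U\<close>.
\<close>

fun nsum :: "'m::comm_monoid_add set \<Rightarrow> nat \<Rightarrow> 'm set" where
  "nsum U 0 = {0}"
| "nsum U (Suc k) = {u + v | u v. u \<in> U \<and> v \<in> nsum U k}"

lemma nsum_SucI: "u \<in> U \<Longrightarrow> v \<in> nsum U k \<Longrightarrow> u + v \<in> nsum U (Suc k)"
  by auto

lemma finite_nsum: "finite U \<Longrightarrow> finite (nsum U k)"
proof (induction k)
  case (Suc k)
  have "nsum U (Suc k) = (\<lambda>(u, v). u + v) ` (U \<times> nsum U k)" by auto
  then show ?case using Suc by simp
qed simp

lemma nsum_nonempty: "U \<noteq> {} \<Longrightarrow> nsum U k \<noteq> {}"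
  by (induction k) auto

lemma nsum_add: "u \<in> nsum U k \<Longrightarrow> v \<in> nsum U l \<Longrightarrow> u + v \<in> nsum U (k + l)"
proof (induction k arbitrary: u)
  case (Suc k)
  then obtain x y where "u = x + y" "x \<in> U" "y \<in> nsum U k" by auto
  with Suc nsum_SucI[of x U "y + v" "k + l"] show ?case by (simp add: add.assoc)
qed simp

lemma nsum_add_split:
  "w \<in> nsum U (k + l) \<Longrightarrow> \<exists>u v. w = u + v \<and> u \<in> nsum U k \<and> v \<in> nsum U l"
proof (induction k arbitrary: w)
  case (Suc k)
  then obtain x w' where x: "w = x + w'" "x \<in> U" "w' \<in> nsum U (k + l)" by auto
  then obtain u v where "w' = u + v" "u \<in> nsum U k" "v \<in> nsum U l" using Suc.IH by blast
  then have "w = (x + u) + v" "x + u \<in> nsum U (Suc k)"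
    using x by (auto simp: add.assoc)
  then show ?case using \<open>v \<in> nsum U l\<close> by blast
qed simp

lemma nsum_nsum: "nsum (nsum U k) q = nsum U (q * k)"
proof (induction q)
  case (Suc q)
  show ?case
  proof (intro Set.set_eqI iffI)
    fix x assume "x \<in> nsum (nsum U k) (Suc q)"
    then show "x \<in> nsum U (Suc q * k)" using Suc nsum_add by fastforce
  next
    fix x assume "x \<in> nsum U (Suc q * k)"
    then show "x \<in> nsum (nsum U k) (Suc q)" using Suc nsum_add_split[of x U k "q * k"] by auto
  qed
qed simp

lemma sum_mset_in_nsum: "set_mset M \<subseteq> U \<Longrightarrow> \<Sum>\<^sub># M \<in> nsum U (size M)"
  by (induction M) auto

lemma nsum_sum_mset: "x \<in> nsum U k \<Longrightarrow> \<exists>M. set_mset M \<subseteq> U \<and> size M = k \<and> x = \<Sum>\<^sub># M"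
proof (induction k arbitrary: x)
  case (Suc k)
  then obtain u v where uv: "x = u + v" "u \<in> U" "v \<in> nsum U k" by auto
  then obtain M where "set_mset M \<subseteq> U" "size M = k" "v = \<Sum>\<^sub># M" using Suc.IH by blast
  then show ?case using uv by (intro exI[of _ "add_mset u M"]) auto
qed simp

lemma nsum_weight_le:
  fixes \<omega> :: "'m::comm_monoid_add \<Rightarrow> real"
  assumes "\<And>a b. \<omega> (a + b) = \<omega> a + \<omega> b" "\<And>u. u \<in> U \<Longrightarrow> c \<le> \<omega> u" "x \<in> nsum U k"
  shows "real k * c \<le> \<omega> x"
  using assms(3)
proof (induction k arbitrary: x)
  case 0
  then show ?case using assms(1)[of 0 0] by simp
next
  case (Suc k)
  then obtain u v where "x = u + v" "u \<in> U" "v \<in> nsum U k" by auto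
  then show ?case using Suc.IH[of v] assms(1)[of u v] assms(2)[of u] by (simp add: algebra_simps)
qed

lemma nsum_mono: "U \<subseteq> V \<Longrightarrow> nsum U k \<subseteq> nsum V k"
  by (induction k) auto

text \<open>
  The exponents of all monomials divisible by a monomial with exponent in \<open>U\<close>.
\<close>

definition upward :: "'m::comm_monoid_add set \<Rightarrow> 'm set" where
  "upward U = {u + b | u b. u \<in> U}"

lemma upwardI: "u \<in> U \<Longrightarrow> a = u + b \<Longrightarrow> a \<in> upward U"
  unfolding upward_def by blast

lemma upwardE:
  assumes "a \<in> upward U" obtains u b where "u \<in> U" "a = u + b"
  using assms unfolding upward_def by blast

definition monomial :: "'m \<Rightarrow> 'm::comm_monoid_add \<Rightarrow>\<^sub>0 'k::comm_ring_1" where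
  "monomial a = Poly_Mapping.single a 1"

lemma monomial_add: "monomial (a + b) = monomial a * monomial b"
  by (simp add: monomial_def mult_single)

lemma monomial_0: "monomial 0 = 1"
  by (simp add: monomial_def)

lemma monomial_expansion:
  "f = (\<Sum>a\<in>Poly_Mapping.keys f. Poly_Mapping.single a (Poly_Mapping.lookup f a))"
proof (rule poly_mapping_eqI)
  fix k
  show "Poly_Mapping.lookup f k
     = Poly_Mapping.lookup (\<Sum>a\<in>Poly_Mapping.keys f. Poly_Mapping.single a (Poly_Mapping.lookup f a)) k"
  proof (cases "k \<in> Poly_Mapping.keys f")
    case True
    then show ?thesis
      by (simp add: lookup_sum lookup_single when_def)
  next
    case False
    then have "(\<Sum>a\<in>Poly_Mapping.keys f. Poly_Mapping.lookup f a when a = k) = 0"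
      by (intro sum.neutral) (auto simp: when_def)
    with False show ?thesis by (simp add: lookup_sum lookup_single in_keys_iff)
  qed
qed

text \<open>
  The polynomials with all exponents in \<open>upward U\<close> form an ideal, because multiplication only adds
  to exponents; conversely such a polynomial is the sum of its terms, each a multiple of a
  generator.
\<close>

lemma ideal_generated_monomials:
  "ideal_generated (monomial ` U :: ('m::comm_monoid_add \<Rightarrow>\<^sub>0 'k::comm_ring_1) set)
    = {f. Poly_Mapping.keys f \<subseteq> upward U}" (is "?L = ?R")
proof
  have "ideal.subspace ?R"
  proof (rule ideal.subspaceI)
    show "c * f \<in> ?R" if f: "f \<in> ?R" for c f
    proof -
      have "a \<in> upward U" if a: "a \<in> Poly_Mapping.keys (c * f)" for a
      proof -
        obtain x y where xy: "a = x + y" "y \<in> Poly_Mapping.keys f"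
          using a keys_mult[of c f] by blast
        then have "y \<in> upward U" using f by blast
        then obtain u b where "u \<in> U" "y = u + b" by (rule upwardE)
        then show ?thesis using xy by (intro upwardI[of u _ _ "x + b"]) (simp_all add: ac_simps)
      qed
      then show ?thesis by blast
    qed
    show "f + g \<in> ?R" if "f \<in> ?R" "g \<in> ?R" for f g
      using that keys_add[of f g] by auto
  qed simp
  moreover have "monomial ` U \<subseteq> ?R"
    by (auto simp: monomial_def intro!: upwardI[where b = 0])
  ultimately show "?L \<subseteq> ?R" by (rule ideal.span_minimal[rotated])
next
  show "?R \<subseteq> ?L"
  proof
    fix f assume f: "f \<in> ?R"
    have "Poly_Mapping.single a (Poly_Mapping.lookup f a) \<in> ?L" if a: "a \<in> Poly_Mapping.keys f" for a
    proof -
      have "a \<in> upward U" using f a by blast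
      then obtain u b where "u \<in> U" "a = u + b" by (rule upwardE)
      then have "Poly_Mapping.single a (Poly_Mapping.lookup f a)
          = Poly_Mapping.single b (Poly_Mapping.lookup f a) * monomial u"
        by (simp add: monomial_def mult_single add.commute)
      also have "\<dots> \<in> ?L"
        using \<open>u \<in> U\<close> by (intro ideal.span_scale ideal.span_base) blast
      finally show ?thesis .
    qed
    then have "(\<Sum>a\<in>Poly_Mapping.keys f. Poly_Mapping.single a (Poly_Mapping.lookup f a)) \<in> ?L"
      by (rule ideal.span_sum)
    then show "f \<in> ?L" using monomial_expansion[of f] by simp
  qed
qed

lemma ideal_power_monomials:
  fixes U :: "'m::comm_monoid_add set"
  shows "ideal_power (ideal_generated (monomial ` U :: ('m \<Rightarrow>\<^sub>0 'k::comm_ring_1) set)) k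
    = ideal_generated (monomial ` nsum U k)"
proof (induction k)
  case 0
  have "upward {0 :: 'm} = UNIV" by (auto simp: upward_def)
  then show ?case unfolding ideal_generated_monomials by simp
next
  case (Suc k)
  let ?P = "{a * b | a b :: 'm \<Rightarrow>\<^sub>0 'k. a \<in> ideal_generated (monomial ` U) \<and> b \<in> ideal_generated (monomial ` nsum U k)}"
  have "?P \<subseteq> ideal_generated (monomial ` nsum U (Suc k))"
  proof
    fix h assume "h \<in> ?P"
    then obtain f g where h: "h = f * g" and f: "f \<in> ideal_generated (monomial ` U)"
      and g: "g \<in> ideal_generated (monomial ` nsum U k)" by auto
    have "a \<in> upward (nsum U (Suc k))" if a: "a \<in> Poly_Mapping.keys (f * g)" for a
    proof -
      obtain x y where xy: "a = x + y" "x \<in> Poly_Mapping.keys f" "y \<in> Poly_Mapping.keys g"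
        using a keys_mult[of f g] by blast
      have "x \<in> upward U" "y \<in> upward (nsum U k)"
        using f g xy unfolding ideal_generated_monomials by blast+
      then obtain u b v c where "u \<in> U" "x = u + b" "v \<in> nsum U k" "y = v + c"
        by (elim upwardE) rule
      then show ?thesis using xy
        by (intro upwardI[of "u + v" _ _ "b + c"] nsum_SucI) (simp_all add: ac_simps)
    qed
    then show "h \<in> ideal_generated (monomial ` nsum U (Suc k))"
      unfolding h ideal_generated_monomials by blast
  qed
  moreover have "monomial ` nsum U (Suc k) \<subseteq> ?P"
  proof
    fix h :: "'m \<Rightarrow>\<^sub>0 'k" assume "h \<in> monomial ` nsum U (Suc k)"
    then obtain u v where "h = monomial u * monomial v" "u \<in> U" "v \<in> nsum U k"
      by (auto simp: monomial_add)
    moreover have "monomial u \<in> ideal_generated (monomial ` U)"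
        "monomial v \<in> ideal_generated (monomial ` nsum U k)"
      using calculation by (auto intro: ideal.span_base)
    ultimately show "h \<in> ?P" by blast
  qed
  ultimately have "ideal_generated ?P = ideal_generated (monomial ` nsum U (Suc k))"
    by (intro antisym ideal.span_mono ideal.span_minimal ideal.subspace_span)
  then show ?case unfolding ideal_power.simps Suc .
qed

definition indicator_exponent :: "'n set \<Rightarrow> 'n \<Rightarrow>\<^sub>0 nat" where
  "indicator_exponent F = (\<Sum>i\<in>F. Poly_Mapping.single i 1)"

lemma lookup_indicator_exponent:
  "finite F \<Longrightarrow> Poly_Mapping.lookup (indicator_exponent F) i = (if i \<in> F then 1 else 0)"
  by (simp add: indicator_exponent_def lookup_sum lookup_single when_def)

lemma edge_ideal_monomials:
  fixes \<Delta> :: "'n::finite set set"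
  shows "(edge_ideal \<Delta> :: ('n, 'k::field) mpoly set) = ideal_generated (monomial ` indicator_exponent ` \<Delta>)"
proof -
  have "(\<Prod>i\<in>F. Var i :: ('n, 'k::field) mpoly) = monomial (indicator_exponent F)" if "finite F" for F
    using that by induction
      (simp_all add: indicator_exponent_def monomial_0 monomial_add Var_def monomial_def mult_single)
  then show ?thesis by (simp add: edge_ideal_def image_image)
qed

lemma cover_prime_monomials:
  "cover_prime C = ideal_generated (monomial ` (\<lambda>i. Poly_Mapping.single i 1) ` C)"
  by (simp add: cover_prime_def image_image Var_def[abs_def] monomial_def)

text \<open>
  A monomial whose degree in the variables of \<open>C\<close> is positive is divisible by one of them, and the
  quotient has degree one less; so the powers of a cover prime are given by this degree alone.
\<close>

lemma upward_nsum_units: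
  fixes C :: "'n::finite set"
  shows "upward (nsum ((\<lambda>i. Poly_Mapping.single i 1) ` C) k) = {a. k \<le> (\<Sum>i\<in>C. Poly_Mapping.lookup a i)}"
proof (induction k)
  case 0
  show ?case by (auto simp: upward_def)
next
  case (Suc k)
  let ?U = "(\<lambda>i. Poly_Mapping.single i (1::nat)) ` C"
  let ?deg = "\<lambda>a. \<Sum>i\<in>C. Poly_Mapping.lookup a i"
  have deg_add: "?deg (a + b) = ?deg a + ?deg b" for a b :: "'n \<Rightarrow>\<^sub>0 nat"
    by (simp add: lookup_add sum.distrib)
  have deg_unit: "?deg (Poly_Mapping.single i (1::nat)) = 1" if "i \<in> C" for i :: 'n
    using that by (simp add: lookup_single when_def)
  show ?case
  proof (intro Set.set_eqI iffI)
    fix a assume "a \<in> upward (nsum ?U (Suc k))"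
    then obtain i v b where i: "i \<in> C" "v \<in> nsum ?U k" "a = Poly_Mapping.single i 1 + (v + b)"
      by (auto simp: upward_def add.assoc)
    then have "v + b \<in> upward (nsum ?U k)" by (auto intro: upwardI)
    then show "a \<in> {a. Suc k \<le> ?deg a}" using Suc i deg_unit by (simp add: deg_add del: One_nat_def)
  next
    fix a :: "'n \<Rightarrow>\<^sub>0 nat" assume a: "a \<in> {a. Suc k \<le> ?deg a}"
    then obtain i where i: "i \<in> C" "Poly_Mapping.lookup a i \<noteq> 0"
      by (metis (mono_tags, lifting) mem_Collect_eq not_less_eq_eq sum.neutral zero_le)
    define b where "b = a - Poly_Mapping.single i 1"
    have ab: "a = Poly_Mapping.single i 1 + b"
      using i by (intro poly_mapping_eqI) (auto simp: b_def lookup_add lookup_minus lookup_single when_def)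
    have "b \<in> upward (nsum ?U k)"
      using a Suc i deg_unit unfolding ab by (simp add: deg_add del: One_nat_def)
    then obtain v c where "v \<in> nsum ?U k" "b = v + c" by (auto elim: upwardE)
    then show "a \<in> upward (nsum ?U (Suc k))"
      unfolding ab using i by (intro upwardI[of "Poly_Mapping.single i 1 + v" _ _ c] nsum_SucI) (simp_all add: add.assoc)
  qed
qed

lemma symbolic_power_iff:
  fixes \<Delta> :: "'n::finite set set"
  shows "f \<in> symbolic_power \<Delta> k \<longleftrightarrow>
    (\<forall>a\<in>Poly_Mapping.keys f. \<forall>C\<in>minimal_vertex_covers \<Delta>. k \<le> (\<Sum>i\<in>C. Poly_Mapping.lookup a i))"
  unfolding symbolic_power_def cover_prime_monomials
  unfolding ideal_power_monomials unfolding ideal_generated_monomials upward_nsum_units by (auto simp: subset_iff)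

section \<open>Weights of integral elements\<close>

text \<open>
  If \<open>\<phi>\<close> has unique minima \<open>a\<close> and \<open>b\<close> on the exponents of \<open>f\<close> and \<open>g\<close>, then \<open>a + b\<close> arises
  in only one way as a sum of exponents, so the product of the two terms is not cancelled in
  \<open>f * g\<close>.
\<close>

lemma keys_mult_strict_minimum:
  fixes f g :: "'m::cancel_comm_monoid_add \<Rightarrow>\<^sub>0 'k::idom" and \<phi> :: "'m \<Rightarrow> real"
  assumes add: "\<And>x y. \<phi> (x + y) = \<phi> x + \<phi> y"
    and a: "a \<in> Poly_Mapping.keys f" "\<And>x. \<lbrakk>x \<in> Poly_Mapping.keys f; x \<noteq> a\<rbrakk> \<Longrightarrow> \<phi> a < \<phi> x"
    and b: "b \<in> Poly_Mapping.keys g" "\<And>y. \<lbrakk>y \<in> Poly_Mapping.keys g; y \<noteq> b\<rbrakk> \<Longrightarrow> \<phi> b < \<phi> y"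
  shows "a + b \<in> Poly_Mapping.keys (f * g)"
    and "\<And>z. \<lbrakk>z \<in> Poly_Mapping.keys (f * g); z \<noteq> a + b\<rbrakk> \<Longrightarrow> \<phi> (a + b) < \<phi> z"
proof -
  have le: "\<phi> a \<le> \<phi> x" "\<phi> b \<le> \<phi> y"
    if "x \<in> Poly_Mapping.keys f" "y \<in> Poly_Mapping.keys g" for x y
    using a(2)[OF that(1)] b(2)[OF that(2)] by force+
  let ?T = "\<lambda>x. Poly_Mapping.lookup f x * (\<Sum>y. Poly_Mapping.lookup g y when a + b = x + y)"
  have "?T x = (Poly_Mapping.lookup f a * Poly_Mapping.lookup g b when x = a)" for x
  proof (cases "x = a")
    case True
    then show ?thesis by simp
  next
    case False
    have "?T x = 0"
    proof (cases "x \<in> Poly_Mapping.keys f")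
      case True
      have "(Poly_Mapping.lookup g y when a + b = x + y) = 0" for y
      proof (cases "y \<in> Poly_Mapping.keys g \<and> a + b = x + y")
        case y: True
        then have "\<phi> a + \<phi> b = \<phi> x + \<phi> y" using add by metis
        with a(2)[OF True False] le(2)[OF True] y show ?thesis by fastforce
      qed (auto simp: in_keys_iff when_def)
      then show ?thesis by simp
    qed (simp add: in_keys_iff)
    with False show ?thesis by simp
  qed
  then have "Poly_Mapping.lookup (f * g) (a + b) = Poly_Mapping.lookup f a * Poly_Mapping.lookup g b"
    unfolding lookup_mult by simp
  then show "a + b \<in> Poly_Mapping.keys (f * g)"
    using a(1) b(1) by (simp add: in_keys_iff)
  show "\<phi> (a + b) < \<phi> z" if z: "z \<in> Poly_Mapping.keys (f * g)" "z \<noteq> a + b" for z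
  proof -
    obtain x y where xy: "z = x + y" "x \<in> Poly_Mapping.keys f" "y \<in> Poly_Mapping.keys g"
      using z(1) keys_mult[of f g] by blast
    then have "x \<noteq> a \<or> y \<noteq> b" using z(2) by blast
    then show ?thesis
      using a(2)[OF xy(2)] b(2)[OF xy(3)] le[OF xy(2,3)] unfolding xy(1) add by force
  qed
qed

text \<open>
  The weight \<open>\<omega>\<close> records the position of the extremal exponent of the power (which is \<open>s\<close> times
  \<open>a\<close>) as far as it matters later.
\<close>

lemma keys_power_strict_minimum:
  fixes f :: "'m::cancel_comm_monoid_add \<Rightarrow>\<^sub>0 'k::idom" and \<phi> \<omega> :: "'m \<Rightarrow> real"
  assumes add: "\<And>x y. \<phi> (x + y) = \<phi> x + \<phi> y" "\<And>x y. \<omega> (x + y) = \<omega> x + \<omega> y"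
    and a: "a \<in> Poly_Mapping.keys f" "\<And>x. \<lbrakk>x \<in> Poly_Mapping.keys f; x \<noteq> a\<rbrakk> \<Longrightarrow> \<phi> a < \<phi> x"
  shows "\<exists>b\<in>Poly_Mapping.keys (f ^ s). \<omega> b = real s * \<omega> a \<and>
    (\<forall>x\<in>Poly_Mapping.keys (f ^ s). x \<noteq> b \<longrightarrow> \<phi> b < \<phi> x)"
proof (induction s)
  case 0
  show ?case using add(2)[of 0 0] by simp
next
  case (Suc s)
  then obtain b where b: "b \<in> Poly_Mapping.keys (f ^ s)" "\<omega> b = real s * \<omega> a"
    "\<And>x. \<lbrakk>x \<in> Poly_Mapping.keys (f ^ s); x \<noteq> b\<rbrakk> \<Longrightarrow> \<phi> b < \<phi> x" by blast
  show ?case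
    using keys_mult_strict_minimum[OF add(1) a b(1,3)] b(2)
    by (intro bexI[of _ "a + b"]) (simp_all add: add(2) algebra_simps)
qed

lemma keys_power_weight_ge:
  fixes f :: "'m::comm_monoid_add \<Rightarrow>\<^sub>0 'k::comm_ring_1" and \<omega> :: "'m \<Rightarrow> real"
  assumes add: "\<And>x y. \<omega> (x + y) = \<omega> x + \<omega> y"
    and c: "\<And>x. x \<in> Poly_Mapping.keys f \<Longrightarrow> c \<le> \<omega> x"
  shows "x \<in> Poly_Mapping.keys (f ^ s) \<Longrightarrow> real s * c \<le> \<omega> x"
proof (induction s arbitrary: x)
  case 0
  then show ?case using add[of 0 0] by simp
next
  case (Suc s)
  then obtain y z where yz: "x = y + z" "y \<in> Poly_Mapping.keys f" "z \<in> Poly_Mapping.keys (f ^ s)"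
    using keys_mult[of f "f ^ s"] by auto
  then show ?case using c[OF yz(2)] Suc.IH[OF yz(3)] by (simp add: add algebra_simps)
qed

text \<open>
  Uniqueness of the minimum is obtained by perturbing \<open>\<omega>\<close>. Among the minimisers of \<open>\<omega>\<close> choose a
  point \<open>a\<close> of largest Euclidean norm. By Cauchy-Schwarz, \<open>a\<close> is the only one of these minimisers
  where the linear form \<open>x \<mapsto> - (a \<bullet> x)\<close> is smallest. Adding this form to \<open>N * \<omega>\<close> for a large \<open>N\<close>
  makes \<open>a\<close> the unique minimum on the whole set.
\<close>

lemma exists_strict_minimum:
  fixes S :: "('n::finite \<Rightarrow>\<^sub>0 nat) set" and \<omega> :: "('n \<Rightarrow>\<^sub>0 nat) \<Rightarrow> real"
  assumes "finite S" "S \<noteq> {}" and add: "\<And>x y. \<omega> (x + y) = \<omega> x + \<omega> y"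
  shows "\<exists>a\<in>S. (\<forall>x\<in>S. \<omega> a \<le> \<omega> x) \<and>
    (\<exists>\<phi> :: _ \<Rightarrow> real. (\<forall>x y. \<phi> (x + y) = \<phi> x + \<phi> y) \<and> (\<forall>x\<in>S. x \<noteq> a \<longrightarrow> \<phi> a < \<phi> x))"
proof -
  define B :: "('n \<Rightarrow>\<^sub>0 nat) \<Rightarrow> ('n \<Rightarrow>\<^sub>0 nat) \<Rightarrow> real" where
    "B x y = (\<Sum>i\<in>UNIV. real (Poly_Mapping.lookup x i) * real (Poly_Mapping.lookup y i))" for x y
  define S0 where "S0 = {x \<in> S. \<omega> x = Min (\<omega> ` S)}"
  have "Min (\<omega> ` S) \<in> \<omega> ` S" using assms by (intro Min_in) simp_all
  then have "S0 \<noteq> {}" by (auto simp: S0_def)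
  have "finite S0" using \<open>finite S\<close> by (simp add: S0_def)
  then have "Max ((\<lambda>x. B x x) ` S0) \<in> (\<lambda>x. B x x) ` S0"
    using \<open>S0 \<noteq> {}\<close> by (intro Max_in) simp_all
  then obtain a where a: "a \<in> S0" "B a a = Max ((\<lambda>x. B x x) ` S0)" by auto
  have aS: "a \<in> S" and amin: "\<And>x. x \<in> S \<Longrightarrow> \<omega> a \<le> \<omega> x"
    using a(1) \<open>finite S\<close> by (auto simp: S0_def)
  have amax: "B x x \<le> B a a" if "x \<in> S0" for x
    unfolding a(2) using \<open>finite S0\<close> that by simp
  \<comment> \<open>A large factor \<open>N\<close> makes \<open>\<omega>\<close> decide whenever it distinguishes \<open>a\<close> from \<open>x\<close>.\<close>
  have "\<forall>x\<in>S. eventually (\<lambda>N. \<omega> a < \<omega> x \<longrightarrow> B a x - B a a < N * (\<omega> x - \<omega> a)) at_top"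
  proof
    fix x
    have "eventually (\<lambda>N. (B a x - B a a) / (\<omega> x - \<omega> a) < N) at_top"
      by (rule eventually_gt_at_top)
    then show "eventually (\<lambda>N. \<omega> a < \<omega> x \<longrightarrow> B a x - B a a < N * (\<omega> x - \<omega> a)) at_top"
      by eventually_elim (auto simp: pos_divide_less_eq)
  qed
  then have "eventually (\<lambda>N. \<forall>x\<in>S. \<omega> a < \<omega> x \<longrightarrow> B a x - B a a < N * (\<omega> x - \<omega> a)) at_top"
    using \<open>finite S\<close> by (rule eventually_ball_finite[rotated])
  then obtain N where N: "\<And>x. \<lbrakk>x \<in> S; \<omega> a < \<omega> x\<rbrakk> \<Longrightarrow> B a x - B a a < N * (\<omega> x - \<omega> a)"
    unfolding eventually_at_top_linorder by blast
  define \<phi> where "\<phi> x = N * \<omega> x - B a x" for x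
  have "\<phi> (x + y) = \<phi> x + \<phi> y" for x y
    by (simp add: \<phi>_def B_def add lookup_add sum.distrib algebra_simps)
  moreover have "\<phi> a < \<phi> x" if x: "x \<in> S" "x \<noteq> a" for x
  proof (cases "\<omega> a < \<omega> x")
    case True
    then show ?thesis using N[OF x(1) True] by (simp add: \<phi>_def algebra_simps)
  next
    case False
    then have eq: "\<omega> x = \<omega> a" using amin[OF x(1)] by simp
    then have "x \<in> S0" using x a(1) by (simp add: S0_def)
    obtain i where i: "Poly_Mapping.lookup a i \<noteq> Poly_Mapping.lookup x i"
      using x(2) poly_mapping_eqI by metis
    have "0 < (\<Sum>i\<in>UNIV. (real (Poly_Mapping.lookup a i) - real (Poly_Mapping.lookup x i))\<^sup>2)"
      by (rule sum_pos2[of _ i]) (use i in auto)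
    also have "\<dots> = B a a + B x x - 2 * B a x"
      by (simp add: B_def power2_diff power2_eq_square sum.distrib sum_subtractf sum_distrib_left algebra_simps)
    finally show ?thesis using amax[OF \<open>x \<in> S0\<close>] eq by (simp add: \<phi>_def)
  qed
  ultimately show ?thesis using aS amin by blast
qed

text \<open>
  If the least weight \<open>m\<close> on \<open>f\<close> were below \<open>c\<close>, then in an equation of integral dependence the
  terms \<open>g\<^sub>j f\<^sup>s\<^sup>-\<^sup>j\<close> have weights at least \<open>j c + (s - j) m > s m\<close>, so none of them can cancel the
  term of weight \<open>s m\<close> that survives in \<open>f\<^sup>s\<close>.
\<close>

theorem weight_ge_of_integral:
  fixes f :: "('n::finite, 'k::field) mpoly" and \<omega> :: "('n \<Rightarrow>\<^sub>0 nat) \<Rightarrow> real"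
  assumes f: "f \<in> integral_closure J"
    and add: "\<And>x y. \<omega> (x + y) = \<omega> x + \<omega> y"
    and J: "\<And>j g x. \<lbrakk>g \<in> ideal_power J j; x \<in> Poly_Mapping.keys g\<rbrakk> \<Longrightarrow> real j * c \<le> \<omega> x"
    and x: "x \<in> Poly_Mapping.keys f"
  shows "c \<le> \<omega> x"
proof -
  obtain s g where "1 \<le> s" and g: "\<And>j. j \<in> {1..s} \<Longrightarrow> g j \<in> ideal_power J j"
    and eq: "f ^ s + (\<Sum>j=1..s. g j * f ^ (s - j)) = 0"
    using f unfolding integral_closure_def by blast
  obtain a \<phi> where a: "a \<in> Poly_Mapping.keys f" "\<And>x. x \<in> Poly_Mapping.keys f \<Longrightarrow> \<omega> a \<le> \<omega> x"
    and \<phi>: "\<And>x y. \<phi> (x + y) = \<phi> x + \<phi> y" "\<And>x. \<lbrakk>x \<in> Poly_Mapping.keys f; x \<noteq> a\<rbrakk> \<Longrightarrow> \<phi> a < (\<phi> x :: real)"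
    using exists_strict_minimum[of "Poly_Mapping.keys f" \<omega>] add x by (metis empty_iff finite_keys)
  obtain b where b: "b \<in> Poly_Mapping.keys (f ^ s)" "\<omega> b = real s * \<omega> a"
    using keys_power_strict_minimum[of \<phi> \<omega>, OF \<phi>(1) add a(1) \<phi>(2)] by blast
  have "Poly_Mapping.lookup (f ^ s) b + Poly_Mapping.lookup (\<Sum>j=1..s. g j * f ^ (s - j)) b = 0"
    using eq by (simp flip: lookup_add)
  then have "b \<in> Poly_Mapping.keys (\<Sum>j=1..s. g j * f ^ (s - j))"
    using b(1) by (auto simp: in_keys_iff)
  then obtain j where j: "j \<in> {1..s}" "b \<in> Poly_Mapping.keys (g j * f ^ (s - j))"
    using keys_sum[of "\<lambda>j. g j * f ^ (s - j)" "{1..s}"] by blast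
  then obtain y z where yz: "b = y + z" "y \<in> Poly_Mapping.keys (g j)" "z \<in> Poly_Mapping.keys (f ^ (s - j))"
    using keys_mult[of "g j" "f ^ (s - j)"] by blast
  have "real j * c \<le> \<omega> y" using J g j(1) yz(2) by blast
  moreover have "real (s - j) * \<omega> a \<le> \<omega> z"
    using keys_power_weight_ge[of \<omega>, OF add a(2) yz(3)] .
  ultimately have "real j * c + real (s - j) * \<omega> a \<le> real s * \<omega> a"
    using b(2) yz(1) add by simp
  then have "real j * c \<le> real j * \<omega> a" using j(1) by (simp add: of_nat_diff algebra_simps)
  then have "c \<le> \<omega> a" using j(1) by simp
  then show ?thesis using a(2)[OF x] by simp
qed

section \<open>Integral polynomials over a monomial ideal\<close>

text \<open>
  Perturbing the zero weight gives a linear form with a unique minimum on the exponents of \<open>f\<close>; the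
  term where it is attained survives in the product.
\<close>

lemma mult_monomial_eq_0D:
  fixes f :: "('n::finite, 'k::field) mpoly"
  assumes "f * monomial b = 0"
  shows "f = 0"
proof (rule ccontr)
  assume "f \<noteq> 0"
  then have "Poly_Mapping.keys f \<noteq> {}" by (metis in_keys_iff empty_iff lookup_zero poly_mapping_eqI)
  then have "\<exists>a\<in>Poly_Mapping.keys f. \<exists>\<phi> :: _ \<Rightarrow> real. (\<forall>x y. \<phi> (x + y) = \<phi> x + \<phi> y) \<and>
      (\<forall>x\<in>Poly_Mapping.keys f. x \<noteq> a \<longrightarrow> \<phi> a < \<phi> x)"
    using exists_strict_minimum[of "Poly_Mapping.keys f" "\<lambda>_. 0"] by simp
  then obtain a and \<phi> :: "_ \<Rightarrow> real" where "a \<in> Poly_Mapping.keys f" "\<forall>x y. \<phi> (x + y) = \<phi> x + \<phi> y"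
    "\<forall>x\<in>Poly_Mapping.keys f. x \<noteq> a \<longrightarrow> \<phi> a < \<phi> x"
    by blast
  then have "a + b \<in> Poly_Mapping.keys (f * monomial b)"
    by (intro keys_mult_strict_minimum[of \<phi>]) (simp_all add: monomial_def)
  then show False by (simp add: assms)
qed

text \<open>
  Read additively, the ideal \<open>L\<close> generated by the monomials of \<open>E\<close> and \<open>Y\<close> satisfies
  \<open>L\<^sup>N\<^sup>+\<^sup>1 = J L\<^sup>N\<close> for large \<open>N\<close>, where \<open>J\<close> is generated by \<open>E\<close>. A product of \<open>N + 1\<close> generators
  either has a factor from \<open>E\<close>, or by the pigeonhole principle has a factor \<open>a\<close> from \<open>Y\<close> with
  multiplicity at least \<open>m a\<close>; those \<open>m a\<close> factors may be exchanged for \<open>m a\<close> factors from \<open>E\<close>.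
\<close>

lemma exchange_step:
  fixes E Y :: "'m::comm_monoid_add set"
  assumes "finite Y" and m: "\<And>a. a \<in> Y \<Longrightarrow> 1 \<le> m a"
    and mE: "\<And>a. a \<in> Y \<Longrightarrow> \<Sum>\<^sub># (replicate_mset (m a) a) \<in> upward (nsum E (m a))"
    and x: "x \<in> nsum (E \<union> Y) (Suc (sum m Y))"
  shows "\<exists>e\<in>upward E. \<exists>h\<in>nsum (E \<union> Y) (sum m Y). x = e + h"
proof -
  obtain M where M: "set_mset M \<subseteq> E \<union> Y" "size M = Suc (sum m Y)" "x = \<Sum>\<^sub># M"
    using nsum_sum_mset[OF x] by blast
  show ?thesis
  proof (cases "\<exists>e\<in>#M. e \<in> E")
    case True
    then obtain e M' where e: "e \<in> E" "M = add_mset e M'" by (metis mset_add)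
    then have "\<Sum>\<^sub># M' \<in> nsum (E \<union> Y) (sum m Y)"
      using M sum_mset_in_nsum[of M' "E \<union> Y"] by simp
    moreover have "e \<in> upward E" using e(1) by (rule upwardI[where b = 0]) simp
    ultimately show ?thesis using e(2) M(3) by auto
  next
    case False
    then have "set_mset M \<subseteq> Y" using M(1) by blast
    have "\<exists>a\<in>set_mset M. m a \<le> count M a"
    proof (rule ccontr)
      assume "\<not> (\<exists>a\<in>set_mset M. m a \<le> count M a)"
      then have "size M \<le> sum m (set_mset M)"
        unfolding size_multiset_overloaded_eq by (intro sum_mono) auto
      also have "\<dots> \<le> sum m Y" using \<open>finite Y\<close> \<open>set_mset M \<subseteq> Y\<close> by (intro sum_mono2) auto
      finally show False using M(2) by simp
    qed
    then obtain a where a: "a \<in> Y" "m a \<le> count M a" using \<open>set_mset M \<subseteq> Y\<close> by blast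
    then obtain M' where M': "M = replicate_mset (m a) a + M'"
      by (metis count_le_replicate_mset_subset_eq mset_subset_eq_exists_conv)
    obtain l where l: "m a = Suc l" using m[OF a(1)] by (cases "m a") auto
    obtain u b where u: "u \<in> nsum E (Suc l)" "\<Sum>\<^sub># (replicate_mset (m a) a) = u + b"
      using mE[OF a(1)] unfolding l by (rule upwardE)
    then obtain e v where ev: "e \<in> E" "v \<in> nsum E l" "u = e + v" by auto
    have "v + \<Sum>\<^sub># M' \<in> nsum (E \<union> Y) (l + size M')"
      using ev(2) nsum_mono[of E "E \<union> Y" l] M(1) unfolding M'
      by (intro nsum_add sum_mset_in_nsum) auto
    moreover have "l + size M' = sum m Y" using M(2) unfolding M' l by simp
    moreover have "x = (e + b) + (v + \<Sum>\<^sub># M')"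
      using M(3) unfolding M' by (simp add: u(2) ev(3) ac_simps)
    moreover have "e + b \<in> upward E" using ev(1) by (rule upwardI) simp
    ultimately show ?thesis by metis
  qed
qed

text \<open>
  The hypothesis says that every monomial of \<open>f\<close> has a power \<open>q\<close> in the \<open>q\<close>-th power of the ideal
  \<open>J\<close> generated by \<open>E\<close>. The determinant trick applies to the module spanned by the monomials in \<open>G\<close>:
  by the exchange step, each term of \<open>f\<close> maps each of these into \<open>J\<close> times one of
  them.
\<close>

theorem integral_of_monomial_powers:
  fixes f :: "('n::finite, 'k::field) mpoly" and E :: "('n \<Rightarrow>\<^sub>0 nat) set"
  assumes "finite E"
    and keys: "\<And>a. a \<in> Poly_Mapping.keys f \<Longrightarrow>
      \<exists>q\<ge>1. \<Sum>\<^sub># (replicate_mset q a) \<in> upward (nsum E q)"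
  shows "f \<in> integral_closure (ideal_generated (monomial ` E))"
proof (cases "Poly_Mapping.keys f = {}")
  case True
  then have "f = 0" by (metis in_keys_iff empty_iff lookup_zero poly_mapping_eqI)
  then show ?thesis unfolding integral_closure_def
    by (auto intro!: exI[of _ 1] exI[of _ "\<lambda>_. 0"] simp: ideal_power_zero)
next
  case False
  define Y where "Y = Poly_Mapping.keys f"
  obtain m where m: "\<And>a. a \<in> Y \<Longrightarrow> 1 \<le> m a"
    "\<And>a. a \<in> Y \<Longrightarrow> \<Sum>\<^sub># (replicate_mset (m a) a) \<in> upward (nsum E (m a))"
    using keys unfolding Y_def by metis
  have "finite Y" "Y \<noteq> {}" using False by (simp_all add: Y_def)
  define G where "G = nsum (E \<union> Y) (sum m Y)"
  have "finite G" unfolding G_def using \<open>finite E\<close> \<open>finite Y\<close> by (intro finite_nsum) simp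
  obtain g where "g \<in> G" using nsum_nonempty[of "E \<union> Y" "sum m Y"] \<open>Y \<noteq> {}\<close> unfolding G_def by blast
  have "\<exists>e h. e \<in> upward E \<and> h \<in> G \<and> a + g = e + h" if "a \<in> Y" "g \<in> G" for a g
  proof -
    have "a + g \<in> nsum (E \<union> Y) (Suc (sum m Y))" using that unfolding G_def by (intro nsum_SucI) auto
    from exchange_step[OF \<open>finite Y\<close> m this] show ?thesis unfolding G_def by blast
  qed
  then obtain e h where eh: "\<And>a g. \<lbrakk>a \<in> Y; g \<in> G\<rbrakk> \<Longrightarrow> e a g \<in> upward E"
    "\<And>a g. \<lbrakk>a \<in> Y; g \<in> G\<rbrakk> \<Longrightarrow> h a g \<in> G" "\<And>a g. \<lbrakk>a \<in> Y; g \<in> G\<rbrakk> \<Longrightarrow> a + g = e a g + h a g"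
    by metis
  define t :: "_ \<Rightarrow> _ \<Rightarrow> ('n, 'k) mpoly" where
    "t a g = Poly_Mapping.single (e a g) (Poly_Mapping.lookup f a)" for a g
  define B where "B g g' = (\<Sum>a\<in>Y. if h a g = g' then t a g else 0)" for g g'
  let ?J = "ideal_generated (monomial ` E) :: ('n, 'k) mpoly set"
  show ?thesis
  proof (rule determinant_trick[OF \<open>finite G\<close> \<open>g \<in> G\<close>, where v = monomial and B = B])
    show "x = 0" if "x * monomial g = 0" for x :: "('n, 'k) mpoly"
      using that by (rule mult_monomial_eq_0D)
  next
    fix g g' assume "g \<in> G" "g' \<in> G"
    have "(if h a g = g' then t a g else 0) \<in> ?J" if "a \<in> Y" for a
      using eh(1)[OF that \<open>g \<in> G\<close>] by (simp add: ideal_generated_monomials t_def)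
    then show "B g g' \<in> ?J" unfolding B_def by (rule ideal.span_sum)
  next
    fix g assume g: "g \<in> G"
    have "f * monomial g = (\<Sum>a\<in>Y. Poly_Mapping.single a (Poly_Mapping.lookup f a)) * monomial g"
      unfolding Y_def using monomial_expansion[of f] by simp
    also have "\<dots> = (\<Sum>a\<in>Y. t a g * monomial (h a g))"
      unfolding sum_distrib_right
      by (intro sum.cong) (simp_all add: t_def monomial_def mult_single eh(3)[OF _ g])
    also have "\<dots> = (\<Sum>a\<in>Y. \<Sum>g'\<in>G. if h a g = g' then t a g * monomial g' else 0)"
      using eh(2)[OF _ g] \<open>finite G\<close> by (intro sum.cong) simp_all
    also have "\<dots> = (\<Sum>g'\<in>G. \<Sum>a\<in>Y. if h a g = g' then t a g * monomial g' else 0)"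
      by (rule sum.swap)
    also have "\<dots> = (\<Sum>g'\<in>G. B g g' * monomial g')"
      unfolding B_def sum_distrib_right by (intro sum.cong) simp_all
    finally show "f * monomial g = (\<Sum>g'\<in>G. B g g' * monomial g')" .
  qed
qed

section \<open>The cover polyhedron\<close>

definition exponent_vector :: "('n::finite \<Rightarrow>\<^sub>0 nat) \<Rightarrow> real ^ 'n" where
  "exponent_vector a = (\<chi> i. real (Poly_Mapping.lookup a i))"

definition indicator_vector :: "'n::finite set \<Rightarrow> real ^ 'n" where
  "indicator_vector C = (\<chi> i. if i \<in> C then 1 else 0)"

lemma inner_indicator_vector: "u \<bullet> indicator_vector C = (\<Sum>i\<in>C. u $ i)"
  by (simp add: inner_vec_def indicator_vector_def sum.If_cases if_distrib[of "\<lambda>x. _ * x"] cong: if_cong)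

lemma exponent_vector_indicator:
  "exponent_vector (indicator_exponent F) = indicator_vector F"
  by (simp add: exponent_vector_def indicator_vector_def lookup_indicator_exponent fun_eq_iff)

lemma inner_vec_mono:
  fixes u v w :: "real ^ 'n::finite"
  shows "(\<And>i. 0 \<le> u $ i) \<Longrightarrow> (\<And>i. v $ i \<le> w $ i) \<Longrightarrow> u \<bullet> v \<le> u \<bullet> w"
  unfolding inner_vec_def by (intro sum_mono) (simp add: mult_left_mono)

text \<open>
  The alternative is that \<open>z\<close> belongs to the closed convex set \<open>convex hull A + orthant\<close> or is
  strictly separated from it. As the set is closed under adding nonnegative vectors, a separating
  normal \<open>u\<close> is nonnegative; the bound \<open>b\<close> then exceeds \<open>u \<bullet> z \<ge> 0\<close> and can be scaled to 1.
\<close>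

lemma dominated_or_separated:
  fixes A :: "(real ^ 'n::finite) set" and z :: "real ^ 'n"
  assumes "finite A" and z: "\<And>i. 0 \<le> z $ i"
  shows "(\<exists>v\<in>convex hull A. \<forall>i. v $ i \<le> z $ i) \<or>
    (\<exists>u. (\<forall>i. 0 \<le> u $ i) \<and> u \<bullet> z < 1 \<and> (\<forall>x\<in>A. 1 \<le> u \<bullet> x))"
proof -
  define P :: "(real ^ 'n) set" where "P = {y. \<forall>i. 0 \<le> y $ i}"
  define T where "T = (\<Union>x\<in>convex hull A. \<Union>y\<in>P. {x + y})"
  have "closed P" unfolding P_def by (intro closed_Collect_all closed_Collect_le continuous_intros)
  then have "closed T" unfolding T_def
    using \<open>finite A\<close> by (intro compact_closed_sums finite_imp_compact_convex_hull)
  have "convex P" unfolding P_def convex_def by simp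
  then have "convex T" unfolding T_def by (intro convex_sums) simp
  show ?thesis
  proof (cases "z \<in> T")
    case True
    then obtain v y where "v \<in> convex hull A" "\<forall>i. 0 \<le> y $ i" "z = v + y"
      unfolding T_def P_def by blast
    then show ?thesis by (intro disjI1 bexI[of _ v]) simp_all
  next
    case False
    then obtain u b where ub: "u \<bullet> z < b" "\<And>x. x \<in> T \<Longrightarrow> b < u \<bullet> x"
      using separating_hyperplane_closed_point[OF \<open>convex T\<close> \<open>closed T\<close>] by blast
    show ?thesis
    proof (cases "A = {}")
      case True
      then show ?thesis by (intro disjI2 exI[of _ 0]) simp
    next
      case False
      then obtain x0 where x0: "x0 \<in> A" by blast
      have AT: "x + y \<in> T" if "x \<in> A" "y \<in> P" for x y
        using that hull_inc[of x A convex] unfolding T_def by blast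
      have u: "0 \<le> u $ i" for i
      proof (rule ccontr)
        assume "\<not> 0 \<le> u $ i"
        then have neg: "u $ i < 0" by simp
        \<comment> \<open>Moving this far along a coordinate with \<open>u $ i < 0\<close> would violate the separation.\<close>
        define t where "t = \<bar>u \<bullet> x0 - b\<bar> / (- u $ i)"
        have "t *\<^sub>R axis i 1 \<in> P" using neg by (simp add: P_def t_def axis_def divide_nonneg_neg)
        from ub(2)[OF AT[OF x0 this]] have "b < u \<bullet> x0 + t * u $ i"
          by (simp add: inner_add_right inner_axis)
        also have "t * u $ i = - \<bar>u \<bullet> x0 - b\<bar>" using neg by (simp add: t_def)
        finally show False by linarith
      qed
      have "0 \<le> u \<bullet> z" unfolding inner_vec_def using u z by (intro sum_nonneg) simp
      then have "0 < b" using ub(1) by simp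
      show ?thesis
      proof (intro disjI2 exI[of _ "(1 / b) *\<^sub>R u"] conjI allI ballI)
        show "0 \<le> ((1 / b) *\<^sub>R u) $ i" for i using u \<open>0 < b\<close> by simp
        show "(1 / b) *\<^sub>R u \<bullet> z < 1" using ub(1) \<open>0 < b\<close> by simp
        show "1 \<le> (1 / b) *\<^sub>R u \<bullet> x" if "x \<in> A" for x
          using ub(2)[OF AT[OF that, of 0]] \<open>0 < b\<close> by (simp add: P_def)
      qed
    qed
  qed
qed

lemma cover_polyhedron_iff:
  "w \<in> cover_polyhedron \<Delta> \<longleftrightarrow> (\<forall>i. 0 \<le> w $ i) \<and> (\<forall>F\<in>\<Delta>. 1 \<le> w \<bullet> indicator_vector F)"
  by (simp add: cover_polyhedron_def inner_indicator_vector)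

lemma cover_polyhedron_nonneg: "w \<in> cover_polyhedron \<Delta> \<Longrightarrow> 0 \<le> w $ i"
  by (simp add: cover_polyhedron_def)

lemma cover_polyhedron_upward:
  assumes "v \<in> cover_polyhedron \<Delta>" "\<And>i. v $ i \<le> w $ i"
  shows "w \<in> cover_polyhedron \<Delta>"
proof -
  have "0 \<le> w $ i" for i using assms cover_polyhedron_nonneg order_trans by blast
  moreover have "1 \<le> (\<Sum>i\<in>F. w $ i)" if "F \<in> \<Delta>" for F
    using assms(1) that sum_mono[of F "\<lambda>i. v $ i" "\<lambda>i. w $ i"] assms(2)
    unfolding cover_polyhedron_def by force
  ultimately show ?thesis by (simp add: cover_polyhedron_def)
qed

lemma indicator_vector_in_cover_polyhedron:
  assumes "vertex_cover \<Delta> C"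
  shows "indicator_vector C \<in> cover_polyhedron \<Delta>"
proof -
  have "1 \<le> (\<Sum>i\<in>F. indicator_vector C $ i)" if F: "F \<in> \<Delta>" for F
  proof -
    obtain i where i: "i \<in> C" "i \<in> F" using assms F unfolding vertex_cover_def by blast
    then have "indicator_vector C $ i \<le> (\<Sum>i\<in>F. indicator_vector C $ i)"
      by (intro member_le_sum) (simp_all add: indicator_vector_def)
    then show ?thesis using i by (simp add: indicator_vector_def)
  qed
  then show ?thesis by (simp add: cover_polyhedron_def indicator_vector_def)
qed

section \<open>The integral closure of powers of the edge ideal\<close>

lemma lookup_sum_mset:
  "Poly_Mapping.lookup (\<Sum>\<^sub># M) i = (\<Sum>x\<in>#M. Poly_Mapping.lookup x i)"
  by (induction M) (simp_all add: lookup_add)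

lemma lookup_sum_replicate_mset:
  fixes a :: "'n \<Rightarrow>\<^sub>0 nat"
  shows "Poly_Mapping.lookup (\<Sum>\<^sub># (replicate_mset q a)) i = q * Poly_Mapping.lookup a i"
  by (simp add: lookup_sum_mset)

lemma upward_eq_pointwise:
  fixes a u :: "'n \<Rightarrow>\<^sub>0 nat"
  assumes "u \<in> U" "\<And>i. Poly_Mapping.lookup u i \<le> Poly_Mapping.lookup a i"
  shows "a \<in> upward U"
  using assms by (intro upwardI[of u _ _ "a - u"])
    (auto intro!: poly_mapping_eqI simp: lookup_add lookup_minus)

text \<open>
  By Dirichlet's theorem all the products \<open>q * \<theta> s\<close> are simultaneously close to integers \<open>t s\<close>. All
  constraints on \<open>\<theta>\<close> have integer data, so if the approximation is good enough they hold for \<open>t\<close>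
  without any error.
\<close>

lemma integral_multiple:
  fixes S :: "('n::finite \<Rightarrow>\<^sub>0 nat) set" and \<theta> :: "_ \<Rightarrow> real"
  assumes "finite S" and \<theta>: "\<And>s. s \<in> S \<Longrightarrow> 0 \<le> \<theta> s" "sum \<theta> S = real k"
    and le: "\<And>i. (\<Sum>s\<in>S. \<theta> s * real (Poly_Mapping.lookup s i)) \<le> real (Poly_Mapping.lookup a i)"
  shows "\<exists>q\<ge>1. \<Sum>\<^sub># (replicate_mset q a) \<in> upward (nsum S (q * k))"
proof -
  define n where "n = card S"
  obtain h where h: "bij_betw h {0..<n} S"
    using ex_bij_betw_nat_finite[OF \<open>finite S\<close>] n_def by blast
  define W where "W i = (\<Sum>s\<in>S. Poly_Mapping.lookup s i)" for i
  \<comment> \<open>With precision \<open>1 / N\<close>, the total error of each of the constraints is less than 1.\<close>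
  define N where "N = card S + (\<Sum>i\<in>UNIV. W i) + 1"
  have "N > 0" and cardN: "card S < N" by (simp_all add: N_def)
  have WN: "W i < N" for i using member_le_sum[of i UNIV W] by (simp add: N_def)
  obtain q p where "0 < q" and p: "\<And>i. i < n \<Longrightarrow> \<bar>of_int q * \<theta> (h i) - of_int (p i)\<bar> < 1 / N"
    using Dirichlet_approx_simult[OF \<open>N > 0\<close>, where \<theta> = "\<lambda>i. \<theta> (h i)" and n = n] by blast
  define Q where "Q = nat q"
  have Q: "1 \<le> Q" "real_of_int q = real Q" using \<open>0 < q\<close> by (simp_all add: Q_def)
  define t where "t s = nat (p (the_inv_into {0..<n} h s))" for s
  have approx: "\<bar>real Q * \<theta> s - real (t s)\<bar> < 1 / N" if s: "s \<in> S" for s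
  proof -
    obtain i where i: "i < n" "s = h i" using h s by (auto simp: bij_betw_def)
    then have inv: "the_inv_into {0..<n} h s = i"
      using h by (simp add: bij_betw_def the_inv_into_f_f)
    \<comment> \<open>The rounded value exceeds \<open>-1\<close>, so its conversion to a natural number changes nothing.\<close>
    have "1 / real N \<le> 1" using \<open>N > 0\<close> by simp
    moreover have "0 \<le> real Q * \<theta> s" using \<theta>(1)[OF s] by simp
    ultimately have "- 1 < real_of_int (p i)" using p[OF i(1)] Q(2) i(2) by (simp add: abs_less_iff)
    then have "real (t s) = real_of_int (p i)" by (simp add: t_def inv)
    then show ?thesis using p[OF i(1)] Q(2) i(2) by simp
  qed
  define M where "M = (\<Sum>s\<in>S. replicate_mset (t s) s)"
  have lookup_M: "Poly_Mapping.lookup (\<Sum>\<^sub># M) i = (\<Sum>s\<in>S. t s * Poly_Mapping.lookup s i)" for i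
    unfolding M_def using \<open>finite S\<close> by induction (simp_all add: lookup_add lookup_sum_replicate_mset)
  have size_M: "size M = sum t S" unfolding M_def by (simp add: size_multiset_sum)
  have set_M: "set_mset M \<subseteq> S" unfolding M_def using \<open>finite S\<close>
    by (auto simp: set_mset_sum split: if_splits)
  \<comment> \<open>Each constraint holds for \<open>t\<close> with an error below 1, hence exactly, as both sides are integers.\<close>
  have "Q * k \<le> sum t S"
  proof -
    have "real (Q * k) - real (sum t S) = (\<Sum>s\<in>S. real Q * \<theta> s - real (t s))"
      by (simp add: sum_subtractf \<theta>(2) flip: sum_distrib_left)
    also have "\<dots> \<le> (\<Sum>s\<in>S. 1 / real N)" using approx by (intro sum_mono) force
    also have "\<dots> < 1" using cardN by simp
    finally show ?thesis by linarith
  qed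
  then obtain r where "sum t S = Q * k + r" using le_Suc_ex by blast
  then have "\<Sum>\<^sub># M \<in> nsum S (Q * k + r)" using sum_mset_in_nsum[OF set_M] size_M by simp
  then obtain u v where uv: "\<Sum>\<^sub># M = u + v" "u \<in> nsum S (Q * k)" using nsum_add_split by blast
  have "Poly_Mapping.lookup u i \<le> Q * Poly_Mapping.lookup a i" for i
  proof -
    have "real (Poly_Mapping.lookup (\<Sum>\<^sub># M) i) - real Q * (\<Sum>s\<in>S. \<theta> s * real (Poly_Mapping.lookup s i))
       = (\<Sum>s\<in>S. (real (t s) - real Q * \<theta> s) * real (Poly_Mapping.lookup s i))"
      by (simp add: lookup_M sum_distrib_left sum_subtractf algebra_simps)
    also have "\<dots> \<le> (\<Sum>s\<in>S. 1 / real N * real (Poly_Mapping.lookup s i))"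
      using approx by (intro sum_mono mult_right_mono) force+
    also have "\<dots> = real (W i) / real N" by (simp add: W_def sum_divide_distrib)
    also have "\<dots> < 1" using WN \<open>N > 0\<close> by simp
    finally have "real (Poly_Mapping.lookup (\<Sum>\<^sub># M) i) < 1 + real Q * real (Poly_Mapping.lookup a i)"
      using mult_left_mono[OF le[of i], of "real Q"] by simp
    then have "Poly_Mapping.lookup (\<Sum>\<^sub># M) i < 1 + Q * Poly_Mapping.lookup a i"
      by (metis of_nat_1 of_nat_add of_nat_less_iff of_nat_mult)
    then show ?thesis by (simp add: uv(1) lookup_add)
  qed
  then have "\<Sum>\<^sub># (replicate_mset Q a) \<in> upward (nsum S (Q * k))"
    using uv(2) by (intro upward_eq_pointwise[of u]) (simp_all add: lookup_sum_replicate_mset)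
  then show ?thesis using Q(1) by blast
qed

text \<open>
  Scaled by \<open>1 / k\<close>, the vector \<open>a\<close> cannot be separated from the edge vectors by a nonnegative \<open>u\<close>,
  since such a \<open>u\<close> would be a point of the cover polyhedron violating the bound. So \<open>a\<close> dominates \<open>k\<close>
  times a convex combination of edge vectors.
\<close>

lemma multiple_in_power:
  fixes \<Delta> :: "'n::finite set set"
  assumes "1 \<le> k" and bound: "\<And>w. w \<in> cover_polyhedron \<Delta> \<Longrightarrow> real k \<le> exponent_vector a \<bullet> w"
  shows "\<exists>q\<ge>1. \<Sum>\<^sub># (replicate_mset q a) \<in> upward (nsum (indicator_exponent ` \<Delta>) (q * k))"
proof -
  define S where "S = indicator_exponent ` \<Delta>"
  define z where "z = (1 / real k) *\<^sub>R exponent_vector a"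
  have "finite S" unfolding S_def by simp
  have inj: "inj_on exponent_vector S"
    unfolding exponent_vector_def by (intro inj_onI poly_mapping_eqI) (simp add: fun_eq_iff vec_eq_iff)
  have "\<not> (\<exists>u. (\<forall>i. 0 \<le> u $ i) \<and> u \<bullet> z < 1 \<and> (\<forall>x\<in>exponent_vector ` S. 1 \<le> u \<bullet> x))"
  proof safe
    fix u assume u: "\<forall>i. 0 \<le> u $ i" "u \<bullet> z < 1" "\<forall>x\<in>exponent_vector ` S. 1 \<le> u \<bullet> x"
    then have "u \<in> cover_polyhedron \<Delta>"
      by (simp add: cover_polyhedron_iff S_def exponent_vector_indicator)
    then have "real k \<le> u \<bullet> exponent_vector a" using bound by (simp add: inner_commute)
    then show False using u(2) \<open>1 \<le> k\<close> by (simp add: z_def divide_less_eq)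
  qed
  then obtain v where v: "v \<in> convex hull (exponent_vector ` S)" "\<And>i. v $ i \<le> z $ i"
    using dominated_or_separated[of "exponent_vector ` S" z] \<open>finite S\<close>
    by (auto simp: z_def exponent_vector_def)
  then obtain c where c: "\<And>x. x \<in> exponent_vector ` S \<Longrightarrow> 0 \<le> c x" "sum c (exponent_vector ` S) = 1"
    "(\<Sum>x\<in>exponent_vector ` S. c x *\<^sub>R x) = v"
    using \<open>finite S\<close> by (auto simp: convex_hull_finite)
  have "\<exists>q\<ge>1. \<Sum>\<^sub># (replicate_mset q a) \<in> upward (nsum S (q * k))"
  proof (rule integral_multiple[OF \<open>finite S\<close>, where \<theta> = "\<lambda>s. real k * c (exponent_vector s)"])
    show "0 \<le> real k * c (exponent_vector s)" if "s \<in> S" for s using c(1) that by simp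
    show "(\<Sum>s\<in>S. real k * c (exponent_vector s)) = real k"
      using c(2) by (simp add: sum.reindex[OF inj] flip: sum_distrib_left)
    show "(\<Sum>s\<in>S. real k * c (exponent_vector s) * real (Poly_Mapping.lookup s i))
        \<le> real (Poly_Mapping.lookup a i)" for i
    proof -
      have "v $ i = (\<Sum>s\<in>S. c (exponent_vector s) * real (Poly_Mapping.lookup s i))"
        unfolding c(3)[symmetric] by (simp add: sum.reindex[OF inj]) (simp add: exponent_vector_def)
      then have "(\<Sum>s\<in>S. real k * c (exponent_vector s) * real (Poly_Mapping.lookup s i)) = real k * v $ i"
        by (simp add: sum_distrib_left mult.assoc)
      also have "\<dots> \<le> real k * z $ i" using v(2) by (simp add: mult_left_mono)
      also have "\<dots> = real (Poly_Mapping.lookup a i)"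
        using \<open>1 \<le> k\<close> by (simp add: z_def exponent_vector_def)
      finally show ?thesis .
    qed
  qed
  then show ?thesis unfolding S_def .
qed

text \<open>
  The right-hand side says that all exponents of \<open>f\<close> lie in \<open>k\<close> times the Newton polyhedron of the
  edge ideal, which is described here through its dual, the cover polyhedron.
\<close>

theorem integral_closure_edge_ideal_power_iff:
  fixes \<Delta> :: "'n::finite set set" and f :: "('n, 'k::field) mpoly"
  assumes "1 \<le> k"
  shows "f \<in> integral_closure (ideal_power (edge_ideal \<Delta>) k) \<longleftrightarrow>
    (\<forall>a\<in>Poly_Mapping.keys f. \<forall>w\<in>cover_polyhedron \<Delta>. real k \<le> exponent_vector a \<bullet> w)"
    (is "?L \<longleftrightarrow> ?R")
proof
  let ?S = "indicator_exponent ` \<Delta>"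
  have power: "ideal_power (edge_ideal \<Delta> :: ('n, 'k) mpoly set) k = ideal_generated (monomial ` nsum ?S k)"
    unfolding edge_ideal_monomials ideal_power_monomials ..
  {
    assume f: ?L
    show ?R
    proof (intro ballI)
      fix a w assume a: "a \<in> Poly_Mapping.keys f" and w: "w \<in> cover_polyhedron \<Delta>"
      let ?\<omega> = "\<lambda>a. exponent_vector a \<bullet> w"
      have add: "?\<omega> (x + y) = ?\<omega> x + ?\<omega> y" for x y
        by (simp add: exponent_vector_def inner_vec_def lookup_add sum.distrib algebra_simps)
      have nonneg: "0 \<le> ?\<omega> x" for x
        unfolding inner_vec_def using cover_polyhedron_nonneg[OF w]
        by (intro sum_nonneg) (simp add: exponent_vector_def)
      have S: "1 \<le> ?\<omega> x" if "x \<in> ?S" for x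
        using that w by (auto simp: exponent_vector_indicator cover_polyhedron_iff inner_commute)
      show "real k \<le> ?\<omega> a"
      proof (rule weight_ge_of_integral[OF f add _ a])
        fix j x and g :: "('n, 'k) mpoly"
        assume g: "g \<in> ideal_power (ideal_power (edge_ideal \<Delta>) k) j" and x: "x \<in> Poly_Mapping.keys g"
        have "x \<in> upward (nsum ?S (j * k))"
          using g x unfolding power ideal_power_monomials nsum_nsum
          unfolding ideal_generated_monomials by blast
        then obtain u b where "u \<in> nsum ?S (j * k)" "x = u + b" by (rule upwardE)
        then show "real j * real k \<le> ?\<omega> x"
          using nsum_weight_le[of ?\<omega> ?S 1 u "j * k", OF add S] nonneg[of b] by (simp add: add)
      qed
    qed
  next
    assume ?R
    then show ?L unfolding power
      using multiple_in_power[OF assms, of \<Delta>]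
      by (intro integral_of_monomial_powers finite_nsum) (simp_all add: nsum_nsum)
  }
qed

section \<open>Extreme points of the cover polyhedron\<close>

lemma convex_cover_polyhedron:
  fixes \<Delta> :: "'n::finite set set"
  shows "convex (cover_polyhedron \<Delta>)"
proof -
  have "cover_polyhedron \<Delta> = (\<Inter>i. {w. 0 \<le> w $ i}) \<inter> (\<Inter>F\<in>\<Delta>. {w. indicator_vector F \<bullet> w \<ge> 1})"
    by (auto simp: cover_polyhedron_iff inner_commute)
  moreover have "convex {w :: real ^ 'n. 0 \<le> w $ i}" for i :: 'n
    unfolding convex_def by simp
  ultimately show ?thesis
    by (auto intro!: convex_Int convex_INT convex_halfspace_ge)
qed

lemma closed_cover_polyhedron:
  fixes \<Delta> :: "'n::finite set set"
  shows "closed (cover_polyhedron \<Delta>)"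
proof -
  have "cover_polyhedron \<Delta> = (\<Inter>i. {w. 0 \<le> w $ i}) \<inter> (\<Inter>F\<in>\<Delta>. {w. 1 \<le> w \<bullet> indicator_vector F})"
    by (auto simp: cover_polyhedron_iff)
  then show ?thesis
    by (auto intro!: closed_Int closed_INT closed_Collect_le continuous_intros)
qed

lemma minimal_vertex_cover_exists:
  fixes C :: "'n::finite set"
  assumes "vertex_cover \<Delta> C"
  shows "\<exists>D\<in>minimal_vertex_covers \<Delta>. D \<subseteq> C"
proof -
  obtain D where D: "vertex_cover \<Delta> D" "D \<subseteq> C"
    and "\<forall>D'\<in>Collect (vertex_cover \<Delta>). D' \<subseteq> D \<longrightarrow> D = D'"
    using finite_has_minimal2[of "Collect (vertex_cover \<Delta>)" C] assms by auto
  then have "D \<in> minimal_vertex_covers \<Delta>" unfolding minimal_vertex_covers_def by auto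
  with D(2) show ?thesis by blast
qed

text \<open>
  The linear form \<open>a\<close> may vanish on some coordinates, and its sublevel sets in the cover polyhedron
  may be unbounded. A small multiple of the all-ones vector is added to make them compact. The face
  where the perturbed form is minimal is then compact and has an extreme point.
\<close>

lemma extreme_point_minimises:
  fixes \<Delta> :: "'n::finite set set" and a :: "real ^ 'n"
  assumes w: "w \<in> cover_polyhedron \<Delta>" "a \<bullet> w < c" and a: "\<And>i. 0 \<le> a $ i"
  shows "\<exists>e. e extreme_point_of cover_polyhedron \<Delta> \<and> a \<bullet> e < c"
proof -
  let ?Q = "cover_polyhedron \<Delta>"
  define one :: "real ^ 'n" where "one = (\<chi> i. 1)"
  define s where "s = one \<bullet> w"
  have "0 \<le> s" unfolding s_def one_def inner_vec_def
    using cover_polyhedron_nonneg[OF w(1)] by (intro sum_nonneg) simp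
  \<comment> \<open>Any \<open>\<epsilon>\<close> with \<open>\<epsilon> * s < c - a \<bullet> w\<close> keeps the perturbed form below \<open>c\<close> at \<open>w\<close>.\<close>
  define \<epsilon> where "\<epsilon> = (c - a \<bullet> w) / (s + 1)"
  have "0 < \<epsilon>" using w(2) \<open>0 \<le> s\<close> by (simp add: \<epsilon>_def)
  define a' where "a' = a + \<epsilon> *\<^sub>R one"
  have "\<epsilon> * s < \<epsilon> * (s + 1)" using \<open>0 < \<epsilon>\<close> by simp
  also have "\<dots> = c - a \<bullet> w" using \<open>0 \<le> s\<close> by (simp add: \<epsilon>_def)
  finally have "\<epsilon> * s < c - a \<bullet> w" .
  then have w': "a' \<bullet> w < c" by (simp add: a'_def s_def inner_add_left)
  have a': "\<epsilon> \<le> a' $ i" "a $ i \<le> a' $ i" for i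
    using a \<open>0 < \<epsilon>\<close> by (simp_all add: a'_def one_def)
  define D where "D = ?Q \<inter> {v. a' \<bullet> v \<le> a' \<bullet> w}"
  have "D \<subseteq> cbox 0 (\<chi> i. (a' \<bullet> w) / \<epsilon>)"
  proof
    fix v assume "v \<in> D"
    then have v: "\<And>i. 0 \<le> v $ i" "a' \<bullet> v \<le> a' \<bullet> w"
      by (auto simp: D_def cover_polyhedron_nonneg)
    have "v $ i \<le> (a' \<bullet> w) / \<epsilon>" for i
    proof -
      have "\<epsilon> * v $ i \<le> a' $ i * v $ i" using a' v(1) by (intro mult_right_mono)
      also have "\<dots> \<le> a' \<bullet> v"
      proof -
        have "0 \<le> a' $ j * v $ j" for j using a'(1)[of j] \<open>0 < \<epsilon>\<close> v(1)[of j] by simp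
        then show ?thesis unfolding inner_vec_def
          using member_le_sum[of i UNIV "\<lambda>j. a' $ j * v $ j"] by simp
      qed
      finally show ?thesis using v(2) \<open>0 < \<epsilon>\<close> by (simp add: field_simps)
    qed
    then show "v \<in> cbox 0 (\<chi> i. (a' \<bullet> w) / \<epsilon>)" using v(1) by (simp add: mem_box_cart)
  qed
  then have "bounded D" using bounded_cbox bounded_subset by blast
  moreover have "closed D" unfolding D_def by (intro closed_Int closed_cover_polyhedron closed_halfspace_le)
  ultimately have "compact D" by (simp add: compact_eq_bounded_closed)
  have "w \<in> D" using w(1) by (simp add: D_def)
  then obtain m where m: "m \<in> D" "\<And>v. v \<in> D \<Longrightarrow> a' \<bullet> m \<le> a' \<bullet> v"
    using continuous_attains_inf[OF \<open>compact D\<close>, of "\<lambda>v. a' \<bullet> v"] by (force intro: continuous_intros)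
  have minQ: "a' \<bullet> m \<le> a' \<bullet> v" if "v \<in> ?Q" for v
    using m that unfolding D_def by (cases "a' \<bullet> v \<le> a' \<bullet> w") auto
  define F where "F = ?Q \<inter> {v. a' \<bullet> v = a' \<bullet> m}"
  have face: "F face_of ?Q"
    unfolding F_def by (rule face_of_Int_supporting_hyperplane_ge[OF convex_cover_polyhedron minQ])
  have "F = D \<inter> {v. a' \<bullet> v = a' \<bullet> m}" using m(1) unfolding F_def D_def by auto
  then have "compact F" using \<open>compact D\<close> by (simp only: compact_Int_closed closed_hyperplane)
  moreover have "convex F" using face face_of_imp_convex by blast
  moreover have "F \<noteq> {}" using m(1) unfolding F_def D_def by blast
  ultimately obtain e where e: "e extreme_point_of F" using extreme_point_exists_convex by blast
  then have "e extreme_point_of ?Q" "e \<in> F" using extreme_point_of_face[OF face] by blast+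
  moreover have "a \<bullet> e < c"
  proof -
    have "a \<bullet> e \<le> a' \<bullet> e"
      using inner_vec_mono[of e a a'] a'(2) \<open>e \<in> F\<close> cover_polyhedron_nonneg
      unfolding F_def by (auto simp: inner_commute)
    also have "\<dots> = a' \<bullet> m" using \<open>e \<in> F\<close> by (simp add: F_def)
    also have "\<dots> < c" using m(1) w' by (simp add: D_def)
    finally show ?thesis .
  qed
  ultimately show ?thesis by blast
qed

text \<open>
  A violating \<open>w\<close> may be taken to be an extreme point \<open>e\<close>. Its nonzero coordinates are then at least
  1 and form a vertex cover, so \<open>e\<close> dominates the indicator vector of a minimal cover.
\<close>

lemma fulkersonian_cover_bound:
  fixes \<Delta> :: "'n::finite set set" and a :: "real ^ 'n"
  assumes "fulkersonian \<Delta>" and a: "\<And>i. 0 \<le> a $ i"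
    and covers: "\<And>C. C \<in> minimal_vertex_covers \<Delta> \<Longrightarrow> c \<le> a \<bullet> indicator_vector C"
    and w: "w \<in> cover_polyhedron \<Delta>"
  shows "c \<le> a \<bullet> w"
proof (rule ccontr)
  assume "\<not> c \<le> a \<bullet> w"
  then obtain e where e: "e extreme_point_of cover_polyhedron \<Delta>" "a \<bullet> e < c"
    using extreme_point_minimises[OF w _ a, of c] by auto
  then have eQ: "e \<in> cover_polyhedron \<Delta>" by (simp add: extreme_point_of_def)
  define C where "C = {i. e $ i \<noteq> 0}"
  have "vertex_cover \<Delta> C"
    unfolding vertex_cover_def
  proof (intro ballI notI)
    fix F assume "F \<in> \<Delta>" "C \<inter> F = {}"
    then have "(\<Sum>i\<in>F. e $ i) = 0" by (intro sum.neutral) (auto simp: C_def)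
    then show False using eQ \<open>F \<in> \<Delta>\<close> by (force simp: cover_polyhedron_def)
  qed
  then obtain D where D: "D \<in> minimal_vertex_covers \<Delta>" "D \<subseteq> C"
    using minimal_vertex_cover_exists by blast
  have "indicator_vector D $ i \<le> e $ i" for i
  proof (cases "i \<in> D")
    case True
    then have "e $ i \<noteq> 0" using D(2) by (auto simp: C_def)
    moreover have "e $ i \<in> \<int>" using \<open>fulkersonian \<Delta>\<close> e(1) unfolding fulkersonian_def by blast
    moreover have "0 \<le> e $ i" using eQ by (rule cover_polyhedron_nonneg)
    ultimately have "1 \<le> e $ i" by (auto elim!: Ints_cases)
    with True show ?thesis by (simp add: indicator_vector_def)
  qed (use cover_polyhedron_nonneg[OF eQ] in \<open>simp add: indicator_vector_def\<close>)
  then have "a \<bullet> indicator_vector D \<le> a \<bullet> e" using a by (intro inner_vec_mono)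
  then show False using covers[OF D(1)] e(2) by simp
qed

text \<open>
  Suppose first that some real vector \<open>u\<close> separates \<open>w\<close> strictly from the indicator vectors of the
  minimal covers. Rounding down a large multiple \<open>N u\<close> changes the degree on each cover by at most
  the number \<open>n\<close> of vertices, so an integral exponent \<open>a\<close> also separates, against the bound for
  \<open>k = N - n\<close>. Hence \<open>w\<close> dominates some \<open>v\<close> in the convex hull of the indicator vectors. The
  reflection \<open>2 w - v\<close> of \<open>v\<close> in \<open>w\<close> also lies in the polyhedron, so \<open>v = w\<close> by extremality, and an
  extreme point of a convex hull is one of the generating points.
\<close>

lemma cover_bound_fulkersonian:
  fixes \<Delta> :: "'n::finite set set"
  assumes bound: "\<And>k a w. \<lbrakk>1 \<le> k; \<And>C. C \<in> minimal_vertex_covers \<Delta> \<Longrightarrow> k \<le> (\<Sum>i\<in>C. Poly_Mapping.lookup a i);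
      w \<in> cover_polyhedron \<Delta>\<rbrakk> \<Longrightarrow> real k \<le> exponent_vector a \<bullet> w"
  shows "fulkersonian \<Delta>"
  unfolding fulkersonian_def
proof (intro allI impI)
  fix w i assume w: "w extreme_point_of cover_polyhedron \<Delta>"
  let ?Q = "cover_polyhedron \<Delta>"
  let ?A = "indicator_vector ` minimal_vertex_covers \<Delta>"
  have wQ: "w \<in> ?Q" using w by (simp add: extreme_point_of_def)
  have w0: "0 \<le> w $ i" for i using wQ by (rule cover_polyhedron_nonneg)
  have AQ: "?A \<subseteq> ?Q"
    using indicator_vector_in_cover_polyhedron unfolding minimal_vertex_covers_def by blast
  have "\<not> (\<exists>u. (\<forall>i. 0 \<le> u $ i) \<and> u \<bullet> w < 1 \<and> (\<forall>x\<in>?A. 1 \<le> u \<bullet> x))"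
  proof safe
    fix u assume u: "\<forall>i. 0 \<le> u $ i" "u \<bullet> w < 1" "\<forall>x\<in>?A. 1 \<le> u \<bullet> x"
    define n where "n = CARD('n)"
    obtain N :: nat where N: "real n / (1 - u \<bullet> w) < real N" using reals_Archimedean2 by blast
    then have N': "real n < real N - real N * (u \<bullet> w)"
      using u(2) by (simp add: pos_divide_less_eq algebra_simps)
    define a :: "'n \<Rightarrow>\<^sub>0 nat" where "a = (\<Sum>i\<in>UNIV. Poly_Mapping.single i (nat \<lfloor>real N * u $ i\<rfloor>))"
    have lookup_a: "Poly_Mapping.lookup a i = nat \<lfloor>real N * u $ i\<rfloor>" for i
      by (simp add: a_def lookup_sum lookup_single when_def)
    have a_le: "real (Poly_Mapping.lookup a i) \<le> real N * u $ i"
      and a_ge: "real N * u $ i - 1 \<le> real (Poly_Mapping.lookup a i)" for i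
      using u(1) by (simp_all add: lookup_a)
    have uw: "0 \<le> u \<bullet> w" unfolding inner_vec_def using u(1) w0 by (intro sum_nonneg) simp
    then have "n < N" using N' by (smt (verit) mult_nonneg_nonneg of_nat_0_le_iff of_nat_less_iff)
    have "N - n \<le> (\<Sum>i\<in>C. Poly_Mapping.lookup a i)" if "C \<in> minimal_vertex_covers \<Delta>" for C
    proof -
      have "real N - real n \<le> real N * (\<Sum>i\<in>C. u $ i) - real (card C)"
      proof -
        have "1 \<le> (\<Sum>i\<in>C. u $ i)" using u(3) that by (simp add: inner_indicator_vector)
        then have "real N \<le> real N * (\<Sum>i\<in>C. u $ i)" using mult_left_mono[of 1 _ "real N"] by simp
        moreover have "card C \<le> n" unfolding n_def by (simp add: card_mono)
        ultimately show ?thesis by simp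
      qed
      also have "\<dots> = (\<Sum>i\<in>C. real N * u $ i - 1)" by (simp add: sum_subtractf sum_distrib_left)
      also have "\<dots> \<le> (\<Sum>i\<in>C. real (Poly_Mapping.lookup a i))" by (intro sum_mono a_ge)
      finally show ?thesis by (simp flip: of_nat_sum)
    qed
    then have "real (N - n) \<le> exponent_vector a \<bullet> w"
      using \<open>n < N\<close> wQ by (intro bound) simp_all
    also have "\<dots> \<le> (real N *\<^sub>R u) \<bullet> w"
      using inner_vec_mono[of w "exponent_vector a" "real N *\<^sub>R u"] w0 a_le
      by (simp add: exponent_vector_def inner_commute)
    finally show False using N' \<open>n < N\<close> by (simp add: of_nat_diff)
  qed
  then obtain v where v: "v \<in> convex hull ?A" "\<And>i. v $ i \<le> w $ i"
    using dominated_or_separated[of ?A w] w0 by auto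
  have hullQ: "convex hull ?A \<subseteq> ?Q" using AQ convex_cover_polyhedron by (rule hull_minimal)
  have "v = w"
  proof (rule ccontr)
    assume "v \<noteq> w"
    have "2 *\<^sub>R w - v \<in> ?Q"
      by (rule cover_polyhedron_upward[OF wQ]) (use v(2) in \<open>simp add: algebra_simps\<close>)
    moreover have "w = midpoint v (2 *\<^sub>R w - v)" by (simp add: midpoint_def)
    moreover have "v \<noteq> 2 *\<^sub>R w - v"
      using \<open>v \<noteq> w\<close> by (metis add_diff_cancel_left' diff_add_cancel scaleR_2 scaleR_cancel_left zero_neq_numeral)
    ultimately show False
      using w v(1) hullQ midpoint_in_open_segment[of v "2 *\<^sub>R w - v"]
      unfolding extreme_point_of_def by auto
  qed
  then have "w extreme_point_of (convex hull ?A)"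
    using w v(1) hullQ unfolding extreme_point_of_def by blast
  then have "w \<in> ?A" by (rule extreme_point_of_convex_hull)
  then show "w $ i \<in> \<int>" by (auto simp: indicator_vector_def)
qed

section \<open>Symbolic powers and integral closures\<close>

theorem theorem2p4:
  fixes \<Delta> :: "'n::finite set set"
  assumes "simple_hypergraph \<Delta>"
  shows "(\<forall>k\<ge>1. integral_closure (ideal_power (edge_ideal \<Delta> :: ('n, 'k::field) mpoly set) k)
            = symbolic_power \<Delta> k)
         \<longleftrightarrow> fulkersonian \<Delta>"
proof
  assume eq: "\<forall>k\<ge>1. integral_closure (ideal_power (edge_ideal \<Delta> :: ('n, 'k) mpoly set) k)
            = symbolic_power \<Delta> k"
  show "fulkersonian \<Delta>"
  proof (rule cover_bound_fulkersonian)
    fix k w and a :: "'n \<Rightarrow>\<^sub>0 nat"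
    assume k: "1 \<le> k" and w: "w \<in> cover_polyhedron \<Delta>"
      and a: "\<And>C. C \<in> minimal_vertex_covers \<Delta> \<Longrightarrow> k \<le> (\<Sum>i\<in>C. Poly_Mapping.lookup a i)"
    have "(monomial a :: ('n, 'k) mpoly) \<in> symbolic_power \<Delta> k"
      using a by (simp add: symbolic_power_iff monomial_def)
    then have "(monomial a :: ('n, 'k) mpoly) \<in> integral_closure (ideal_power (edge_ideal \<Delta>) k)"
      using eq k by blast
    then show "real k \<le> exponent_vector a \<bullet> w"
      using k w by (simp add: integral_closure_edge_ideal_power_iff monomial_def)
  qed
next
  assume fulk: "fulkersonian \<Delta>"
  show "\<forall>k\<ge>1. integral_closure (ideal_power (edge_ideal \<Delta> :: ('n, 'k) mpoly set) k)
            = symbolic_power \<Delta> k"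
  proof (intro allI impI)
    fix k :: nat assume k: "1 \<le> k"
    have deg: "exponent_vector a \<bullet> indicator_vector C = real (\<Sum>i\<in>C. Poly_Mapping.lookup a i)"
      for a and C :: "'n set"
      by (simp add: inner_indicator_vector exponent_vector_def)
    have "(\<forall>w\<in>cover_polyhedron \<Delta>. real k \<le> exponent_vector a \<bullet> w) \<longleftrightarrow>
        (\<forall>C\<in>minimal_vertex_covers \<Delta>. k \<le> (\<Sum>i\<in>C. Poly_Mapping.lookup a i))" (is "?Q \<longleftrightarrow> ?C") for a
    proof
      assume Q: ?Q
      show ?C
      proof
        fix C assume "C \<in> minimal_vertex_covers \<Delta>"
        then have "indicator_vector C \<in> cover_polyhedron \<Delta>"
          by (intro indicator_vector_in_cover_polyhedron) (simp add: minimal_vertex_covers_def)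
        then show "k \<le> (\<Sum>i\<in>C. Poly_Mapping.lookup a i)"
          using Q deg[of a C] by (metis of_nat_le_iff)
      qed
    next
      assume C: ?C
      show ?Q
      proof
        fix w assume w: "w \<in> cover_polyhedron \<Delta>"
        show "real k \<le> exponent_vector a \<bullet> w"
        proof (rule fulkersonian_cover_bound[OF fulk _ _ w])
          show "0 \<le> exponent_vector a $ i" for i by (simp add: exponent_vector_def)
          show "real k \<le> exponent_vector a \<bullet> indicator_vector C"
            if "C \<in> minimal_vertex_covers \<Delta>" for C
            unfolding deg using C that by (simp only: of_nat_le_iff)
        qed
      qed
    qed
    then show "integral_closure (ideal_power (edge_ideal \<Delta> :: ('n, 'k) mpoly set) k) = symbolic_power \<Delta> k"
      by (auto simp: set_eq_iff integral_closure_edge_ideal_power_iff[OF k] symbolic_power_iff)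
  qed
qed

end
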